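(* Let $f,g:\{0,1\}^n\to\{1,-1\}$ be two functions given by oracle access and let $\mathbf{y}\in\{0,1\}^n$. For every accuracy $0<\epsilon\le\frac14$ and error $0<\delta<1$ there exists a quantum algorithm that makes $\mathcal{O}\left(\frac{\pi}{\epsilon}\log\frac1\delta\right)$ queries to the oracles and returns an estimate $\alpha$ such that $$\Pr\left[\alpha-\epsilon\le\frac{C_{f,g}(\mathbf{y})}{2^n}\le\alpha+\epsilon\right]\ge1-\delta .$$
   Context: The cross-correlation of $f,g:\{0,1\}^n\to\{1,-1\}$ at $\mathbf{y}\in\{0,1\}^n$ is $C_{f,g}(\mathbf{y})=\sum_{\mathbf{x}\in\{0,1\}^n}f(\mathbf{x})g(\mathbf{x}\oplus\mathbf{y})$. Quantum query (black-box) model: a query to $h:\{0,1\}^n\to\{1,-1\}$ is one application of the unitary $U_h$ on $n+1$ qubits given by $U_h|\mathbf{x}\rangle|a\rangle=|\mathbf{x}\rangle\left|a\oplus\frac{1-h(\mathbf{x})}{2}\right\rangle$ (possibly controlled on another qubit, or its inverse); between queries an algorithm may apply arbitrary unitaries and measurements that do not depend on the oracle functions. The constant in $\mathcal{O}(\cdot)$ is absolute. *)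

theory Defs
  imports "HOL-Probability.Probability_Mass_Function" "Jordan_Normal_Form.Schur_Decomposition"
begin

unbundle no vec_syntax

text \<open>
  Bit strings in \<open>{0,1}\<^sup>n\<close> are the natural numbers below \<open>2 ^ n\<close> (binary expansion), so
  that bitwise addition is \<^const>\<open>xor\<close> on \<^typ>\<open>nat\<close>, and \<open>2 ^ n\<close>-dimensional vectors and
  matrices are indexed by bit strings.
\<close>

definition sign_functions :: "nat \<Rightarrow> (nat \<Rightarrow> int) set" where
  "sign_functions n = {f. \<forall>x < 2 ^ n. f x \<in> {1, -1}}"

definition cross_correlation :: "nat \<Rightarrow> (nat \<Rightarrow> int) \<Rightarrow> (nat \<Rightarrow> int) \<Rightarrow> nat \<Rightarrow> int" where
  "cross_correlation n f g y = (\<Sum>x < 2 ^ n. f x * g (xor x y))"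


section \<open>Query algorithms\<close>

text \<open>
  The register has \<open>w\<close> workspace qubits, \<open>n\<close> query-input qubits and one query-target qubit. The
  basis state \<open>|z\<rangle>|x\<rangle>|a\<rangle>\<close> with \<open>z < 2 ^ w\<close>, \<open>x < 2 ^ n\<close> and \<open>a < 2\<close> has index
  \<open>z * 2 ^ (n + 1) + 2 * x + a\<close>.
\<close>

definition total_dim :: "nat \<Rightarrow> nat \<Rightarrow> nat" where
  "total_dim n w = 2 ^ w * 2 ^ (n + 1)"

text \<open>\<open>U\<^sub>h |x\<rangle>|a\<rangle> = |x\<rangle>|a \<oplus> (1 - h x) / 2\<rangle>\<close>, where \<open>|x\<rangle>|a\<rangle>\<close> has index \<open>2 * x + a\<close>.\<close>

definition oracle_unitary :: "nat \<Rightarrow> (nat \<Rightarrow> int) \<Rightarrow> complex mat" where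
  "oracle_unitary n h = mat (2 ^ (n + 1)) (2 ^ (n + 1)) (\<lambda>(i, j).
     let x = j div 2; a = j mod 2
     in if i = 2 * x + xor a (nat ((1 - h x) div 2)) then 1 else 0)"

lemma oracle_unitary_ket:
  assumes x: "x < 2 ^ n" and a: "a < 2" and hx: "h x \<in> {1, -1}"
  shows "oracle_unitary n h *\<^sub>v unit_vec (2 ^ (n + 1)) (2 * x + a) =
    unit_vec (2 ^ (n + 1)) (2 * x + xor a (nat ((1 - h x) div 2)))"
proof -
  have a': "a = 0 \<or> a = 1"
    using a by auto
  have k: "2 * x + a < 2 ^ (n + 1)"
    using x a by simp
  have "xor a (nat ((1 - h x) div 2)) < 2"
    using a' hx by auto
  moreover have "2 * x + b < 2 ^ (n + 1)" if "b < 2" for b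
    using x that by simp
  ultimately have lt: "2 * x + xor a (nat ((1 - h x) div 2)) < 2 ^ (n + 1)"
    by blast
  have entry: "(oracle_unitary n h *\<^sub>v unit_vec (2 ^ (n + 1)) (2 * x + a)) $ i =
      oracle_unitary n h $$ (i, 2 * x + a)" if "i < 2 ^ (n + 1)" for i
  proof -
    have "oracle_unitary n h \<in> carrier_mat (2 ^ (n + 1)) (2 ^ (n + 1))"
      by (simp add: oracle_unitary_def)
    then show ?thesis
      using that k by (simp add: scalar_prod_right_unit[of _ "2 ^ (n + 1)"])
  qed
  show ?thesis
    using a k lt by (intro eq_vecI) (auto simp del: index_mult_mat_vec simp add: entry,
      auto simp: oracle_unitary_def)
qed

text \<open>
  \<open>I \<otimes> U\<close> on workspace and query registers or, with \<open>ctrl = Some k\<close>, the operator \<open>U\<close> controlled on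
  workspace qubit \<open>k\<close>: block diagonal, the block of \<open>|z\<rangle>\<close> being \<open>U\<close> if the control bit of
  \<open>z\<close> is set and the identity otherwise.
\<close>

definition lift_query :: "nat \<Rightarrow> nat option \<Rightarrow> complex mat \<Rightarrow> complex mat" where
  "lift_query w ctrl U = (let d = dim_row U in
     mat (2 ^ w * d) (2 ^ w * d) (\<lambda>(i, j).
       if i div d \<noteq> j div d then 0
       else if (case ctrl of None \<Rightarrow> True | Some k \<Rightarrow> bit (i div d) k)
            then U $$ (i mod d, j mod d)
            else 1\<^sub>m d $$ (i mod d, j mod d)))"

datatype oracle_name = Oracle_f | Oracle_g

text \<open>
  \<open>Query o inverted ctrl A\<close> is one application of \<open>U\<^sub>o\<close> (of its adjoint, if \<open>inverted\<close>), possibly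
  controlled. \<open>Measure Ms A\<close> is a measurement with operators \<open>Ms\<close>; the algorithm continues
  with \<open>A i\<close> on outcome \<open>i < length Ms\<close>. Nothing in an algorithm refers to the oracle functions.
\<close>

datatype query_algorithm =
    Output real
  | Unitary "complex mat" query_algorithm
  | Measure "complex mat list" "nat \<Rightarrow> query_algorithm"
  | Query oracle_name bool "nat option" query_algorithm

definition is_unitary :: "nat \<Rightarrow> complex mat \<Rightarrow> bool" where
  "is_unitary d U \<longleftrightarrow> U \<in> carrier_mat d d \<and> mat_adjoint U * U = 1\<^sub>m d \<and> U * mat_adjoint U = 1\<^sub>m d"

text \<open>Measurement operators \<open>M\<^sub>i\<close> are subject to the completeness relation \<open>(\<Sum>i. M\<^sub>i\<^sup>* M\<^sub>i) = I\<close>.\<close>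

definition is_measurement :: "nat \<Rightarrow> complex mat list \<Rightarrow> bool" where
  "is_measurement d Ms \<longleftrightarrow> set Ms \<subseteq> carrier_mat d d \<and>
     foldr (\<lambda>M S. mat_adjoint M * M + S) Ms (0\<^sub>m d d) = 1\<^sub>m d"

primrec wf_algorithm :: "nat \<Rightarrow> nat \<Rightarrow> query_algorithm \<Rightarrow> bool" where
  "wf_algorithm n w (Output r) \<longleftrightarrow> True"
| "wf_algorithm n w (Unitary U A) \<longleftrightarrow> is_unitary (total_dim n w) U \<and> wf_algorithm n w A"
| "wf_algorithm n w (Measure Ms A) \<longleftrightarrow>
     is_measurement (total_dim n w) Ms \<and> (\<forall>i < length Ms. wf_algorithm n w (A i))"
| "wf_algorithm n w (Query nm inverted ctrl A) \<longleftrightarrow>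
     (\<forall>k. ctrl = Some k \<longrightarrow> k < w) \<and> wf_algorithm n w A"

text \<open>Queries to both oracles are counted, in the worst case over the measurement outcomes.\<close>

primrec query_count :: "query_algorithm \<Rightarrow> nat" where
  "query_count (Output r) = 0"
| "query_count (Unitary U A) = query_count A"
| "query_count (Measure Ms A) = Max ((\<lambda>i. query_count (A i)) ` {..<length Ms})"
| "query_count (Query nm inverted ctrl A) = Suc (query_count A)"


section \<open>Output distribution\<close>

definition norm_squared :: "complex Matrix.vec \<Rightarrow> real" where
  "norm_squared v = (\<Sum>i < dim_vec v. (cmod (v $ i))\<^sup>2)"

text \<open>Born rule; see \<open>pmf_outcome\<close> below for well-definedness.\<close>

definition outcome_pmf :: "complex mat list \<Rightarrow> complex Matrix.vec \<Rightarrow> nat pmf" where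
  "outcome_pmf Ms v =
     embed_pmf (\<lambda>i. if i < length Ms then norm_squared ((Ms ! i) *\<^sub>v v) else 0)"

definition normalized :: "complex Matrix.vec \<Rightarrow> complex Matrix.vec" where
  "normalized v = complex_of_real (1 / sqrt (norm_squared v)) \<cdot>\<^sub>v v"

primrec run ::
  "nat \<Rightarrow> nat \<Rightarrow> (oracle_name \<Rightarrow> nat \<Rightarrow> int) \<Rightarrow> query_algorithm \<Rightarrow> complex Matrix.vec \<Rightarrow> real pmf"
where
  "run n w h (Output r) = (\<lambda>v. return_pmf r)"
| "run n w h (Unitary U A) = (\<lambda>v. run n w h A (U *\<^sub>v v))"
| "run n w h (Measure Ms A) =
     (\<lambda>v. bind_pmf (outcome_pmf Ms v) (\<lambda>i. run n w h (A i) (normalized ((Ms ! i) *\<^sub>v v))))"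
| "run n w h (Query nm inverted ctrl A) =
     (\<lambda>v. let U = oracle_unitary n (h nm); V = (if inverted then mat_adjoint U else U)
          in run n w h A (lift_query w ctrl V *\<^sub>v v))"

definition output_distribution ::
  "nat \<Rightarrow> nat \<Rightarrow> (nat \<Rightarrow> int) \<Rightarrow> (nat \<Rightarrow> int) \<Rightarrow> query_algorithm \<Rightarrow> real pmf" where
  "output_distribution n w f g A =
     run n w (case_oracle_name f g) A (unit_vec (total_dim n w) 0)"


section \<open>Well-definedness of the outcome distribution\<close>

lemma norm_squared_nonneg: "norm_squared v \<ge> 0"
  by (simp add: norm_squared_def sum_nonneg)

lemma norm_squared_cscalar: "complex_of_real (norm_squared v) = v \<bullet>c v"
  by (simp add: norm_squared_def scalar_prod_def complex_norm_square atLeast0LessThan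
        del: of_real_power)

lemma mat_adjoint_carrier: "A \<in> carrier_mat r c \<Longrightarrow> mat_adjoint A \<in> carrier_mat c r"
  by (auto simp: mat_adjoint_def)

lemma mat_adjoint_scalar_prod:
  fixes A :: "complex mat"
  assumes A: "A \<in> carrier_mat r c" and u: "u \<in> carrier_vec r" and v: "v \<in> carrier_vec c"
  shows "(mat_adjoint A *\<^sub>v u) \<bullet>c v = u \<bullet>c (A *\<^sub>v v)"
proof -
  have "(mat_adjoint A *\<^sub>v u) \<bullet>c v =
      (\<Sum>j<c. (\<Sum>i<r. cnj (A $$ (i, j)) * u $ i) * cnj (v $ j))"
    using assms by (auto simp: scalar_prod_def mat_adjoint_def atLeast0LessThan mat_of_rows_index
        intro!: sum.cong)
  also have "\<dots> = (\<Sum>i<r. u $ i * cnj (\<Sum>j<c. A $$ (i, j) * v $ j))"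
    by (simp add: sum_distrib_left sum_distrib_right mult_ac)
       (rule sum.swap)
  also have "\<dots> = u \<bullet>c (A *\<^sub>v v)"
    using assms by (auto simp: scalar_prod_def atLeast0LessThan intro!: sum.cong)
  finally show ?thesis .
qed

lemma sum_norm_squared_measurement:
  assumes "is_measurement d Ms" and v: "v \<in> carrier_vec d"
  shows "(\<Sum>i < length Ms. norm_squared ((Ms ! i) *\<^sub>v v)) = norm_squared v"
proof -
  let ?S = "\<lambda>Ms. foldr (\<lambda>M S. mat_adjoint M * M + S) Ms (0\<^sub>m d d)"
  have S: "?S Ms \<in> carrier_mat d d \<and>
     (?S Ms *\<^sub>v v) \<bullet>c v = complex_of_real (\<Sum>M\<leftarrow>Ms. norm_squared (M *\<^sub>v v))"
    if "set Ms \<subseteq> carrier_mat d d" for Ms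
    using that
  proof (induction Ms)
    case Nil
    then show ?case using v by (simp add: scalar_prod_def)
  next
    case (Cons M Ms)
    have M: "M \<in> carrier_mat d d" "mat_adjoint M \<in> carrier_mat d d"
      using Cons.prems mat_adjoint_carrier by auto
    have Mv: "M *\<^sub>v v \<in> carrier_vec d" using M v by simp
    have IH: "?S Ms \<in> carrier_mat d d"
      "(?S Ms *\<^sub>v v) \<bullet>c v = complex_of_real (\<Sum>M\<leftarrow>Ms. norm_squared (M *\<^sub>v v))"
      using Cons by auto
    have "(?S (M # Ms) *\<^sub>v v) \<bullet>c v = (mat_adjoint M *\<^sub>v (M *\<^sub>v v) + ?S Ms *\<^sub>v v) \<bullet>c v"
      using M IH(1) v by (simp add: add_mult_distrib_mat_vec[of _ d d] assoc_mult_mat_vec[of _ d d _ d])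
    also have "\<dots> = (mat_adjoint M *\<^sub>v (M *\<^sub>v v)) \<bullet>c v + (?S Ms *\<^sub>v v) \<bullet>c v"
      using M IH(1) v Mv by (intro add_scalar_prod_distrib[of _ d]) auto
    also have "(mat_adjoint M *\<^sub>v (M *\<^sub>v v)) \<bullet>c v = (M *\<^sub>v v) \<bullet>c (M *\<^sub>v v)"
      using mat_adjoint_scalar_prod M v Mv by blast
    finally show ?case using IH M by (simp add: norm_squared_cscalar)
  qed
  have "complex_of_real (\<Sum>M\<leftarrow>Ms. norm_squared (M *\<^sub>v v)) = complex_of_real (norm_squared v)"
    using S[of Ms] assms by (simp add: is_measurement_def norm_squared_cscalar)
  then have "(\<Sum>M\<leftarrow>Ms. norm_squared (M *\<^sub>v v)) = norm_squared v"
    by (simp only: of_real_eq_iff)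
  then show ?thesis
    by (simp add: sum_list_sum_nth atLeast0LessThan)
qed

lemma pmf_outcome:
  assumes "is_measurement d Ms" "v \<in> carrier_vec d" "norm_squared v = 1"
  shows "pmf (outcome_pmf Ms v) i = (if i < length Ms then norm_squared ((Ms ! i) *\<^sub>v v) else 0)"
proof -
  let ?p = "\<lambda>i. if i < length Ms then norm_squared ((Ms ! i) *\<^sub>v v) else 0"
  have "(\<integral>\<^sup>+ i. ennreal (?p i) \<partial>count_space UNIV) = (\<Sum>i < length Ms. ennreal (?p i))"
    by (rule nn_integral_count_space') auto
  also have "\<dots> = ennreal (\<Sum>i < length Ms. norm_squared ((Ms ! i) *\<^sub>v v))"
    by (simp add: norm_squared_nonneg)
  also have "\<dots> = 1"
    using sum_norm_squared_measurement[OF assms(1,2)] assms(3) by simp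
  finally show ?thesis
    unfolding outcome_pmf_def by (intro pmf_embed_pmf) (auto simp: norm_squared_nonneg)
qed

end

theory Submission
  imports Defs
begin

text \<open>
  Put \<open>h x = f x * g (xor x y)\<close>, let \<open>D\<close> be the diagonal operator with entries \<open>h\<close> (two queries), \<open>\<psi>\<close>
  the uniform superposition and \<open>c = \<langle>\<psi>|D|\<psi>\<rangle>\<close> the normalised correlation. The product
  \<open>W = (2|\<psi>\<rangle>\<langle>\<psi>| - I) D\<close> of two reflections rotates the plane of \<open>\<psi>\<close> and \<open>D \<psi>\<close>, with eigenvalues
  \<open>z\<close> and \<open>cnj z\<close> where \<open>Re z = c\<close>, so phase estimation yields \<open>c\<close>.

  No repetition is needed to reach error \<open>\<delta>\<close>: the control register starts in
  \<open>\<Sum>k. a k |k\<rangle>\<close>, where \<open>a\<close> are the normalised coefficients of \<open>p = ((1 + X + \<dots> + X\<^sup>L\<^sup>-\<^sup>1) / L)\<^sup>m\<close>.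
  If \<open>L\<close> is of order \<open>1 / \<epsilon>\<close>, then the base of this power is at most \<open>1 / 2\<close> in modulus at every phase
  with error above \<open>\<epsilon>\<close>. Bounding all but one of the \<open>m\<close> factors in this way and summing the last one by
  Parseval's identity gives failure probability at most \<open>m / 4 ^ (m - 1)\<close>.

  For \<open>\<delta>\<close> close to \<open>1\<close> the query bound falls below \<open>1 / \<epsilon>\<close>, possibly below \<open>1\<close>. Then one estimates
  with the coarser accuracy \<open>J \<epsilon>\<close> and guesses which of \<open>J\<close> subintervals of length \<open>2 \<epsilon>\<close> contains \<open>c\<close>.
\<close>

section \<open>Fourier basis and window amplitudes\<close>

definition root_unity :: "nat \<Rightarrow> nat \<Rightarrow> complex" where
  "root_unity Q j = cis (2 * pi * real j / real Q)"

lemma norm_root_unity [simp]: "cmod (root_unity Q j) = 1"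
  by (simp add: root_unity_def)

lemma root_unity_power: "root_unity Q j ^ k = root_unity Q k ^ j"
  by (simp add: root_unity_def Complex.DeMoivre mult_ac)

text \<open>Exchanging base and exponent gives a geometric series in \<open>r\<close>, a
  \<open>Q\<close>-th root of unity. For \<open>k \<noteq> l\<close>, \<open>r = 1\<close> would
  make \<open>Q\<close> divide the nonzero \<open>k - l\<close>, whose modulus is below
  \<open>Q\<close>.\<close>

lemma sum_root_unity_powers:
  assumes "k < Q" "l < Q"
  shows "(\<Sum>j<Q. root_unity Q j ^ k * cnj (root_unity Q j ^ l)) = (if k = l then of_nat Q else 0)"
proof -
  have Q: "Q > 0" using assms by simp
  define r where "r = root_unity Q k * cnj (root_unity Q l)"
  have r: "r = cis (2 * pi * (real k - real l) / real Q)"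
    by (simp add: r_def root_unity_def cis_cnj cis_mult diff_divide_distrib algebra_simps)
  have terms: "root_unity Q j ^ k * cnj (root_unity Q j ^ l) = r ^ j" for j
    by (simp add: r_def power_mult_distrib root_unity_power[of Q j])
  have geometric: "(\<Sum>j<Q. root_unity Q j ^ k * cnj (root_unity Q j ^ l)) = (\<Sum>j<Q. r ^ j)"
    by (rule sum.cong[OF refl terms])
  have rQ: "r ^ Q = 1"
    by (simp add: r_def power_mult_distrib root_unity_power[of Q _ Q] flip: complex_cnj_power)
       (simp add: root_unity_def Q)
  show ?thesis
  proof (cases "k = l")
    case True
    then have "r = 1" by (simp add: r)
    then show ?thesis unfolding geometric using True by simp
  next
    case False
    have "r \<noteq> 1"
    proof
      assume "r = 1"
      then have "cos (2 * pi * (real k - real l) / real Q) = 1"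
        by (simp add: r complex_eq_iff)
      then obtain i :: int where "2 * pi * (real k - real l) / real Q = of_int i * 2 * pi"
        by (auto simp: cos_one_2pi_int)
      then have "2 * pi * (real k - real l) = 2 * pi * (of_int i * real Q)"
        using Q by (simp add: nonzero_divide_eq_eq mult_ac)
      then have "real k - real l = of_int i * real Q"
        by simp
      then have eq: "int k - int l = i * int Q"
        by (metis (mono_tags) of_int_diff of_int_eq_iff of_int_mult of_int_of_nat_eq)
      then have "\<bar>i * int Q\<bar> < int Q" using assms by linarith
      then have "i = 0"
        using Q by (simp add: abs_mult)
      then show False using eq False by simp
    qed
    then show ?thesis unfolding geometric using False rQ
      by (simp add: sum_gp_strict)
  qed
qed

lemma Parseval_root_unity:
  "(\<Sum>j<Q. (cmod (\<Sum>k<Q. cnj (root_unity Q j) ^ k * v k))\<^sup>2) = real Q * (\<Sum>k<Q. (cmod (v k))\<^sup>2)"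
proof -
  have "complex_of_real (\<Sum>j<Q. (cmod (\<Sum>k<Q. cnj (root_unity Q j) ^ k * v k))\<^sup>2) =
      (\<Sum>j<Q. \<Sum>k<Q. \<Sum>l<Q.
        v l * cnj (v k) * (root_unity Q j ^ k * cnj (root_unity Q j ^ l)))"
    by (simp add: complex_norm_square sum_product mult_ac del: of_real_power)
       (intro sum.cong refl sum.swap)
  also have "\<dots> = (\<Sum>k<Q. \<Sum>l<Q.
        v l * cnj (v k) * (\<Sum>j<Q. root_unity Q j ^ k * cnj (root_unity Q j ^ l)))"
    unfolding sum_distrib_left by (subst sum.swap, rule sum.cong[OF refl], rule sum.swap)
  also have "\<dots> = (\<Sum>k<Q. \<Sum>l<Q. if k = l then v l * cnj (v k) * of_nat Q else 0)"
    by (intro sum.cong refl) (simp add: sum_root_unity_powers del: complex_cnj_power)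
  also have "\<dots> = complex_of_real (real Q * (\<Sum>k<Q. (cmod (v k))\<^sup>2))"
    by (simp add: complex_norm_square sum_distrib_left mult_ac del: of_real_power)
  finally show ?thesis by (simp only: of_real_eq_iff)
qed

text \<open>
  The coefficients of \<open>((1 + X + \<dots> + X\<^sup>L\<^sup>-\<^sup>1) / L)\<^sup>m\<close>, normalised. They sum to \<open>1\<close> before the
  normalisation, so by Cauchy--Schwarz this costs a factor of at most their number.
\<close>

lemma window_amplitudes:
  assumes L: "L > 0" and m: "m > 0"
  obtains a :: "nat \<Rightarrow> real" where
    "\<And>k. k > m * (L - 1) \<Longrightarrow> a k = 0"
    "(\<Sum>k\<le>m * (L - 1). (a k)\<^sup>2) = 1"
    "\<And>\<zeta>::complex. (cmod (\<Sum>k\<le>m * (L - 1). of_real (a k) * \<zeta> ^ k))\<^sup>2 \<le>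
       real (m * L) * cmod ((\<Sum>k<L. \<zeta> ^ k) / of_nat L) ^ (2 * m)"
proof -
  define T where "T = m * (L - 1)"
  define q :: "real poly" where "q = Polynomial.smult (1 / real L) (\<Sum>k<L. Polynomial.monom 1 k)"
  define p where "p = q ^ m"
  define C where "C = (\<Sum>k\<le>T. (Polynomial.coeff p k)\<^sup>2)"
  define a where "a k = Polynomial.coeff p k / sqrt C" for k
  have "Polynomial.degree (\<Sum>k<L. Polynomial.monom (1::real) k) \<le> L - 1"
    by (intro degree_sum_le) (auto intro: order.trans[OF degree_monom_le])
  then have "Polynomial.degree q \<le> L - 1"
    unfolding q_def using degree_smult_le le_trans by blast
  then have deg: "Polynomial.degree p \<le> T"
    unfolding p_def T_def using degree_power_le[of q m]
    by (metis le_trans mult.commute mult_le_mono2)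
  have eval: "(\<Sum>k\<le>T. of_real (Polynomial.coeff p k) * \<zeta> ^ k) = ((\<Sum>k<L. \<zeta> ^ k) / of_nat L) ^ m"
    for \<zeta> :: complex
  proof -
    interpret map_poly_hom: map_poly_comm_ring_hom complex_of_real ..
    have "(\<Sum>k\<le>T. of_real (Polynomial.coeff p k) * \<zeta> ^ k) = poly (map_poly of_real p) \<zeta>"
      unfolding poly_altdef using deg
      by (intro sum.mono_neutral_cong_right)
         (auto simp: coeff_map_poly degree_map_poly coeff_eq_0)
    also have "\<dots> = (poly (map_poly of_real q) \<zeta>) ^ m"
      by (simp add: p_def map_poly_hom.hom_power)
    also have "poly (map_poly of_real q) \<zeta> = (\<Sum>k<L. \<zeta> ^ k) / of_nat L"
      by (simp add: q_def map_poly_smult map_poly_hom.hom_sum poly_sum map_poly_monom poly_monom)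
    finally show ?thesis .
  qed
  have "complex_of_real (\<Sum>k\<le>T. Polynomial.coeff p k) = 1"
    using eval[of 1] L by simp
  then have sum1: "(\<Sum>k\<le>T. Polynomial.coeff p k) = 1"
    using of_real_eq_1_iff by blast
  have "(\<Sum>k\<le>T. Polynomial.coeff p k)\<^sup>2 \<le> C * (\<Sum>k\<le>T. 1\<^sup>2)"
    using Cauchy_Schwarz_ineq_sum[of "Polynomial.coeff p" "\<lambda>_. 1" "{..T}"] by (simp add: C_def)
  then have C1: "1 \<le> C * (T + 1)" by (simp add: sum1)
  have "T + 1 \<le> m * L"
    using L m by (cases L; cases m) (auto simp: T_def)
  moreover have "C \<ge> 0" by (simp add: C_def sum_nonneg)
  ultimately have "1 \<le> C * real (m * L)"
    using C1 by (smt (verit) mult_left_mono of_nat_mono of_nat_add of_nat_1)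
  moreover have "C > 0" using C1 \<open>C \<ge> 0\<close> by (cases "C = 0") auto
  ultimately have Cinv: "1 / C \<le> real (m * L)" by (simp add: field_simps)
  show ?thesis
  proof
    show "a k = 0" if "k > m * (L - 1)" for k
      using that deg by (simp add: a_def T_def coeff_eq_0)
    show "(\<Sum>k\<le>m * (L - 1). (a k)\<^sup>2) = 1"
      using \<open>C > 0\<close> by (simp add: a_def power_divide C_def T_def flip: sum_divide_distrib)
    show "(cmod (\<Sum>k\<le>m * (L - 1). of_real (a k) * \<zeta> ^ k))\<^sup>2 \<le>
       real (m * L) * cmod ((\<Sum>k<L. \<zeta> ^ k) / of_nat L) ^ (2 * m)" for \<zeta> :: complex
    proof -
      have "(\<Sum>k\<le>T. of_real (a k) * \<zeta> ^ k) = ((\<Sum>k<L. \<zeta> ^ k) / of_nat L) ^ m / of_real (sqrt C)"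
        unfolding eval[symmetric] by (simp add: a_def sum_divide_distrib)
      moreover have square_norm: "(cmod (d ^ m / of_real (sqrt C)))\<^sup>2 = cmod d ^ (2 * m) * (1 / C)" for d
        using \<open>C > 0\<close>
        by (simp add: norm_divide norm_power power_divide mult.commute[of 2 m] flip: power_mult)
      ultimately have "(cmod (\<Sum>k\<le>T. of_real (a k) * \<zeta> ^ k))\<^sup>2 =
          cmod ((\<Sum>k<L. \<zeta> ^ k) / of_nat L) ^ (2 * m) * (1 / C)"
        by (simp only: square_norm)
      also have "\<dots> \<le> cmod ((\<Sum>k<L. \<zeta> ^ k) / of_nat L) ^ (2 * m) * real (m * L)"
        using Cinv by (intro mult_left_mono) auto
      finally show ?thesis by (simp add: T_def mult.commute)
    qed
  qed
qed

section \<open>Concentration of phase estimation around the true phase\<close>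

lemma norm_geometric_sum_le:
  fixes \<zeta> :: complex
  assumes "cmod \<zeta> = 1" "cmod (\<zeta> - 1) \<ge> e" "e > 0"
  shows "cmod (\<Sum>k<L. \<zeta> ^ k) \<le> 2 / e"
proof -
  have "\<zeta> \<noteq> 1" using assms by auto
  then have "cmod (\<Sum>k<L. \<zeta> ^ k) = cmod (1 - \<zeta> ^ L) / cmod (1 - \<zeta>)"
    by (simp add: sum_gp_strict norm_divide)
  also have "\<dots> \<le> 2 / e"
    using assms norm_triangle_ineq4[of 1 "\<zeta> ^ L"]
    by (intro frac_le) (auto simp: norm_power norm_minus_commute)
  finally show ?thesis .
qed

text \<open>The factor \<open>Q\<close> in the bound is the missing normalisation of the Fourier
  vectors. Far outcomes are singled out by real parts, so the same set of them serves
  \<open>z\<close> and \<open>cnj z\<close>.\<close>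

lemma phase_estimation_tail:
  fixes a :: "nat \<Rightarrow> real" and z :: complex
  assumes a0: "\<And>k. k > m * (L - 1) \<Longrightarrow> a k = 0"
    and window: "\<And>\<zeta>::complex. (cmod (\<Sum>k\<le>m * (L - 1). of_real (a k) * \<zeta> ^ k))\<^sup>2 \<le>
       real (m * L) * cmod ((\<Sum>k<L. \<zeta> ^ k) / of_nat L) ^ (2 * m)"
    and L: "L > 0" "real L * e \<ge> 4" and m: "m > 0" and e: "e > 0" and Q: "m * (L - 1) < Q"
    and z: "cmod z = 1"
  shows "(\<Sum>j | j < Q \<and> \<bar>Re (root_unity Q j) - Re z\<bar> > e.
      (cmod (\<Sum>k<Q. cnj (root_unity Q j) ^ k * (of_real (a k) * z ^ k)))\<^sup>2) \<le> Q * (m / 4 ^ (m - 1))"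
proof -
  define B where "B = {j. j < Q \<and> \<bar>Re (root_unity Q j) - Re z\<bar> > e}"
  define D where "D j = cmod (\<Sum>k<L. (cnj (root_unity Q j) * z) ^ k)" for j
  have LQ: "L \<le> Q"
    using Q m L by (cases L; cases m) auto
  have fin: "finite B" by (simp add: B_def)
  have D_le: "D j \<le> real L / 2" if "j \<in> B" for j
  proof -
    let ?\<omega> = "root_unity Q j"
    have "\<bar>Re (z - ?\<omega>)\<bar> \<le> cmod (z - ?\<omega>)" by (rule abs_Re_le_cmod)
    moreover have "cmod (z - ?\<omega>) = cmod (cnj ?\<omega> * z - 1)"
    proof -
      have "cnj ?\<omega> * (z - ?\<omega>) = cnj ?\<omega> * z - 1"
        using complex_norm_square[of ?\<omega>]
        by (simp add: right_diff_distrib mult.commute[of "cnj ?\<omega>" ?\<omega>])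
      then show ?thesis
        by (metis complex_mod_cnj mult_1 norm_mult norm_root_unity)
    qed
    ultimately have "cmod (cnj ?\<omega> * z - 1) \<ge> e"
      using that by (auto simp: B_def)
    then have "D j \<le> 2 / e"
      unfolding D_def using e z by (intro norm_geometric_sum_le) (auto simp: norm_mult)
    \<comment> \<open>The hypothesis \<open>real L * e \<ge> 4\<close> is what makes a window factor
      \<open>D j / L\<close> at most \<open>1 / 2\<close>.\<close>
    also have "\<dots> \<le> real L / 2" using L e by (simp add: field_simps)
    finally show ?thesis .
  qed
  \<comment> \<open>Parseval for the powers \<open>z ^ k\<close> with \<open>k < L\<close>, padded
    by zeros to length \<open>Q\<close>; hence the need for \<open>L \<le> Q\<close>.\<close>
  have Dsum: "(\<Sum>j<Q. (D j)\<^sup>2) = Q * real L"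
  proof -
    have "(\<Sum>j<Q. (D j)\<^sup>2) =
        (\<Sum>j<Q. (cmod (\<Sum>k<Q. cnj (root_unity Q j) ^ k * (if k < L then z ^ k else 0)))\<^sup>2)"
    proof (intro sum.cong refl)
      fix j
      have "(\<Sum>k<L. (cnj (root_unity Q j) * z) ^ k) =
          (\<Sum>k<Q. cnj (root_unity Q j) ^ k * (if k < L then z ^ k else 0))"
        using LQ by (intro sum.mono_neutral_cong_left) (auto simp: power_mult_distrib)
      then show "(D j)\<^sup>2 =
          (cmod (\<Sum>k<Q. cnj (root_unity Q j) ^ k * (if k < L then z ^ k else 0)))\<^sup>2"
        by (simp add: D_def)
    qed
    also have "\<dots> = Q * (\<Sum>k<Q. (cmod (if k < L then z ^ k else 0))\<^sup>2)"
      by (rule Parseval_root_unity)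
    also have "(\<Sum>k<Q. (cmod (if k < L then z ^ k else 0))\<^sup>2) = (\<Sum>k<L. 1)"
      using LQ z by (intro sum.mono_neutral_cong_right) (auto simp: norm_power)
    finally show ?thesis by simp
  qed
  have "(cmod (\<Sum>k<Q. cnj (root_unity Q j) ^ k * (of_real (a k) * z ^ k)))\<^sup>2
      \<le> (m / (4 ^ (m - 1) * L)) * (D j)\<^sup>2" if "j \<in> B" for j
  proof -
    have "(\<Sum>k<Q. cnj (root_unity Q j) ^ k * (of_real (a k) * z ^ k)) =
        (\<Sum>k\<le>m * (L - 1). of_real (a k) * (cnj (root_unity Q j) * z) ^ k)"
      using Q a0 by (intro sum.mono_neutral_cong_right) (auto simp: power_mult_distrib)
    then have "(cmod (\<Sum>k<Q. cnj (root_unity Q j) ^ k * (of_real (a k) * z ^ k)))\<^sup>2 \<le>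
        real (m * L) * (D j / L) ^ (2 * m)"
      using window[of "cnj (root_unity Q j) * z"] by (simp add: D_def norm_divide)
    \<comment> \<open>One square is kept for Parseval; the other \<open>m - 1\<close> squares are
      bounded by \<open>1 / 4\<close>.\<close>
    also have "(D j / L) ^ (2 * m) = ((D j / L)\<^sup>2) ^ (m - 1) * (D j / L)\<^sup>2"
      using m by (metis Suc_diff_1 power_Suc2 power_mult)
    also have "real (m * L) * \<dots> \<le> real (m * L) * ((1 / 4) ^ (m - 1) * (D j / L)\<^sup>2)"
    proof (intro mult_left_mono mult_right_mono power_mono)
      have "D j / L \<le> 1 / 2" using D_le[OF that] L by (simp add: field_simps)
      moreover have "D j / L \<ge> 0" by (simp add: D_def)
      ultimately have "(D j / L)\<^sup>2 \<le> (1 / 2)\<^sup>2" by (intro power_mono)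
      then show "(D j / L)\<^sup>2 \<le> 1 / 4" by (simp add: power_divide)
    qed auto
    also have "\<dots> = (m / (4 ^ (m - 1) * L)) * (D j)\<^sup>2"
      using L by (simp add: field_simps power2_eq_square)
    finally show ?thesis .
  qed
  then have "(\<Sum>j\<in>B. (cmod (\<Sum>k<Q. cnj (root_unity Q j) ^ k * (of_real (a k) * z ^ k)))\<^sup>2)
      \<le> (\<Sum>j\<in>B. (m / (4 ^ (m - 1) * L)) * (D j)\<^sup>2)"
    by (rule sum_mono)
  also have "\<dots> \<le> (\<Sum>j<Q. (m / (4 ^ (m - 1) * L)) * (D j)\<^sup>2)"
    by (rule sum_mono2) (auto simp: B_def)
  also have "\<dots> = Q * (m / 4 ^ (m - 1))"
    unfolding sum_distrib_left[symmetric] Dsum using L by simp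
  finally show ?thesis by (simp add: B_def)
qed

section \<open>Powers of the walk operator\<close>

text \<open>
  Let \<open>\<psi>\<close> be the uniform superposition, \<open>D\<close> a diagonal sign operator and \<open>c = \<langle>\<psi>|D|\<psi>\<rangle>\<close>. Then
  \<open>((2|\<psi>\<rangle>\<langle>\<psi>| - I) D)\<^sup>k \<psi> = p \<psi> + q D \<psi>\<close> with \<open>(p, q) = walk_coeffs c k\<close>.
\<close>

primrec walk_coeffs :: "real \<Rightarrow> nat \<Rightarrow> real \<times> real" where
  "walk_coeffs c 0 = (1, 0)"
| "walk_coeffs c (Suc k) = (2 * c * fst (walk_coeffs c k) + snd (walk_coeffs c k), - fst (walk_coeffs c k))"

text \<open>The functional sending \<open>\<psi>\<close> to \<open>1\<close> and
  \<open>D \<psi>\<close> to \<open>cnj z\<close> is a left eigenvector of the walk with eigenvalue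
  \<open>z\<close>: the recursion becomes multiplication by \<open>z\<close> because
  \<open>2 * c = z + cnj z\<close> and \<open>z * cnj z = 1\<close>.\<close>

lemma walk_coeffs_eigen:
  fixes z :: complex
  assumes "cmod z = 1" "Re z = c"
  shows "of_real (fst (walk_coeffs c k)) + of_real (snd (walk_coeffs c k)) * cnj z = z ^ k"
proof (induction k)
  case (Suc k)
  let ?p = "complex_of_real (fst (walk_coeffs c k))" and ?q = "complex_of_real (snd (walk_coeffs c k))"
  have c: "2 * complex_of_real c = z + cnj z"
    using assms by (simp add: complex_add_cnj)
  have 1: "z * cnj z = 1" using complex_norm_square[of z] assms by simp
  have "of_real (fst (walk_coeffs c (Suc k))) + of_real (snd (walk_coeffs c (Suc k))) * cnj z =
     (z + cnj z) * ?p + ?q - ?p * cnj z"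
    by (simp flip: c)
  also have "\<dots> = z * ?p + (z * cnj z) * ?q" by (simp add: 1 algebra_simps)
  also have "\<dots> = z * (?p + ?q * cnj z)" by (simp add: algebra_simps)
  finally show ?case by (simp add: Suc.IH)
qed auto

text \<open>The norm of \<open>A \<psi> + B D \<psi>\<close> depends on \<open>h\<close> only
  through its mean \<open>Re z\<close>, and averaging over \<open>z\<close> and \<open>cnj z\<close>
  leaves exactly \<open>Re z\<close> in the cross term. This replaces an eigenvector decomposition
  and also covers real \<open>z\<close>, where \<open>z\<close> and \<open>cnj z\<close>
  coincide.\<close>

lemma mean_norm_square_sign_combination:
  fixes A B z :: complex and h :: "nat \<Rightarrow> real"
  assumes "cmod z = 1" "N > 0" "\<And>x. x < N \<Longrightarrow> h x \<in> {1, -1}" "(\<Sum>x<N. h x) = Re z * N"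
  shows "(\<Sum>x<N. (cmod (A + of_real (h x) * B))\<^sup>2) =
    N * (((cmod (A + B * cnj z))\<^sup>2 + (cmod (A + B * z))\<^sup>2) / 2)"
proof -
  have expand: "(cmod (u + v))\<^sup>2 = (cmod u)\<^sup>2 + (cmod v)\<^sup>2 + 2 * Re (u * cnj v)" for u v
    unfolding cmod_power2 by (simp add: power2_eq_square algebra_simps)
  have "(\<Sum>x<N. (cmod (A + of_real (h x) * B))\<^sup>2) =
      (\<Sum>x<N. (cmod A)\<^sup>2 + (cmod B)\<^sup>2 + h x * (2 * Re (A * cnj B)))"
    using assms(3) by (intro sum.cong refl) (fastforce simp: expand norm_mult)
  also have "\<dots> = N * ((cmod A)\<^sup>2 + (cmod B)\<^sup>2 + Re z * (2 * Re (A * cnj B)))"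
    unfolding sum.distrib sum_distrib_right[symmetric] assms(4) by (simp add: algebra_simps)
  also have "(cmod A)\<^sup>2 + (cmod B)\<^sup>2 + Re z * (2 * Re (A * cnj B)) =
      ((cmod (A + B * cnj z))\<^sup>2 + (cmod (A + B * z))\<^sup>2) / 2"
    using assms(1) by (simp add: expand norm_mult algebra_simps)
  finally show ?thesis .
qed

text \<open>For a superposition of walk powers, both eigenvalues contribute with weight
  \<open>1 / 2\<close>. The coefficients \<open>b\<close> will be window amplitudes times Fourier
  phases.\<close>

lemma norm_square_walk_combination:
  fixes b :: "nat \<Rightarrow> complex" and z :: complex and h :: "nat \<Rightarrow> real"
  assumes z: "cmod z = 1" and N: "N > 0" "\<And>x. x < N \<Longrightarrow> h x \<in> {1, -1}" "(\<Sum>x<N. h x) = Re z * N"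
  shows "(\<Sum>x<N. (cmod (\<Sum>k\<in>K. b k *
       of_real (fst (walk_coeffs (Re z) k) + h x * snd (walk_coeffs (Re z) k))))\<^sup>2) =
    N * (((cmod (\<Sum>k\<in>K. b k * z ^ k))\<^sup>2 + (cmod (\<Sum>k\<in>K. b k * cnj z ^ k))\<^sup>2) / 2)"
proof -
  let ?p = "\<lambda>k. complex_of_real (fst (walk_coeffs (Re z) k))"
  let ?q = "\<lambda>k. complex_of_real (snd (walk_coeffs (Re z) k))"
  define A where "A = (\<Sum>k\<in>K. b k * ?p k)"
  define B where "B = (\<Sum>k\<in>K. b k * ?q k)"
  have comb: "A + s * B = (\<Sum>k\<in>K. b k * (?p k + s * ?q k))" for s
    by (simp add: A_def B_def sum_distrib_left sum.distrib algebra_simps)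
  have "(\<Sum>k\<in>K. b k * of_real (fst (walk_coeffs (Re z) k) + h x * snd (walk_coeffs (Re z) k))) =
      A + of_real (h x) * B" for x
    by (simp add: comb)
  moreover have "A + B * cnj z = (\<Sum>k\<in>K. b k * z ^ k)"
    using comb[of "cnj z"] walk_coeffs_eigen[OF z refl] by (simp add: mult.commute)
  moreover have "A + B * z = (\<Sum>k\<in>K. b k * cnj z ^ k)"
    using comb[of z] walk_coeffs_eigen[of "cnj z"] z by (simp add: mult.commute)
  ultimately show ?thesis
    using mean_norm_square_sign_combination[of z N h A B] assms by simp
qed

section \<open>Vectors and matrices indexed by \<open>(z, x, a)\<close>\<close>

lemma sum_div_mod:
  fixes f :: "nat \<Rightarrow> nat \<Rightarrow> 'a :: comm_monoid_add"
  assumes "J > 0"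
  shows "(\<Sum>k<Q * J. f (k div J) (k mod J)) = (\<Sum>j<Q. \<Sum>s<J. f j s)"
proof -
  have "bij_betw (\<lambda>k. (k div J, k mod J)) {..<Q * J} ({..<Q} \<times> {..<J})"
  proof (rule bij_betw_byWitness[where f' = "\<lambda>(j, s). j * J + s"])
    have "j * J + s < Q * J" if "j < Q" "s < J" for j s
    proof -
      have "j * J + s < Suc j * J" using that by simp
      also have "\<dots> \<le> Q * J" using that by (intro mult_le_mono1) auto
      finally show ?thesis .
    qed
    then show "(\<lambda>(j, s). j * J + s) ` ({..<Q} \<times> {..<J}) \<subseteq> {..<Q * J}" by auto
  qed (use assms in \<open>auto simp: less_mult_imp_div_less\<close>)
  from sum.reindex_bij_betw[OF this, of "\<lambda>(j, s). f j s"] show ?thesis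
    by (simp add: sum.cartesian_product)
qed

locale register =
  fixes n w :: nat
begin

definition indices :: "(nat \<times> nat \<times> nat) set" where
  "indices = {..<2 ^ w} \<times> {..<2 ^ n} \<times> {..<2}"

text \<open>Describing vectors and matrices by functions of triples turns products into sums over
  \<open>indices\<close> and confines most of the \<open>div\<close> and \<open>mod\<close>
  arithmetic to one bijection.\<close>

definition decode :: "nat \<Rightarrow> nat \<times> nat \<times> nat" where
  "decode i = (i div 2 ^ (n + 1), i mod 2 ^ (n + 1) div 2, i mod 2 ^ (n + 1) mod 2)"

definition vec_of :: "(nat \<times> nat \<times> nat \<Rightarrow> complex) \<Rightarrow> complex Matrix.vec" where
  "vec_of F = Matrix.vec (total_dim n w) (\<lambda>i. F (decode i))"

definition mat_of :: "(nat \<times> nat \<times> nat \<Rightarrow> nat \<times> nat \<times> nat \<Rightarrow> complex) \<Rightarrow> complex mat" where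
  "mat_of G = Matrix.mat (total_dim n w) (total_dim n w) (\<lambda>(i, j). G (decode i) (decode j))"

lemma finite_indices [simp]: "finite indices"
  by (simp add: indices_def)

lemma sum_indices:
  fixes f :: "nat \<times> nat \<times> nat \<Rightarrow> 'a :: comm_monoid_add"
  shows "sum f indices = (\<Sum>z<2 ^ w. \<Sum>x<2 ^ n. \<Sum>a<2. f (z, x, a))"
  by (simp only: indices_def sum.cartesian_product) (simp add: case_prod_unfold)

lemma bij_decode: "bij_betw decode {..<total_dim n w} indices"
proof (rule bij_betw_byWitness[where f' = "\<lambda>(z, x, a). z * 2 ^ (n + 1) + (2 * x + a)"])
  have lt: "2 * x + a < 2 ^ (n + 1)" if "x < 2 ^ n" "a < 2" for x a :: nat
    using that by simp
  show "\<forall>i\<in>{..<total_dim n w}. (\<lambda>(z, x, a). z * 2 ^ (n + 1) + (2 * x + a)) (decode i) = i"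
    by (simp only: decode_def prod.case mult_div_mod_eq div_mult_mod_eq) simp
  show "\<forall>p\<in>indices. decode ((\<lambda>(z, x, a). z * 2 ^ (n + 1) + (2 * x + a)) p) = p"
  proof
    fix p assume "p \<in> indices"
    then obtain z x a where p: "p = (z, x, a)" "z < 2 ^ w" "x < 2 ^ n" "a < 2"
      by (auto simp: indices_def)
    have "(z * 2 ^ (n + 1) + (2 * x + a)) div 2 ^ (n + 1) = z"
      "(z * 2 ^ (n + 1) + (2 * x + a)) mod 2 ^ (n + 1) = 2 * x + a"
      using lt[OF p(3,4)] by (simp_all del: power_Suc add: add.commute)
    then show "decode ((\<lambda>(z, x, a). z * 2 ^ (n + 1) + (2 * x + a)) p) = p"
      unfolding decode_def p(1) prod.case using p(4) by simp
  qed
  show "decode ` {..<total_dim n w} \<subseteq> indices"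
  proof -
    have "i mod 2 ^ (n + 1) div 2 < 2 ^ n" for i :: nat
      by (rule less_mult_imp_div_less) (simp add: mult.commute)
    then show ?thesis
      by (auto simp: decode_def indices_def total_dim_def less_mult_imp_div_less simp del: power_Suc)
  qed
  show "(\<lambda>(z, x, a). z * 2 ^ (n + 1) + (2 * x + a)) ` indices \<subseteq> {..<total_dim n w}"
  proof clarify
    fix z x a assume "(z, x, a) \<in> indices"
    then have p: "z < 2 ^ w" "x < 2 ^ n" "a < 2" by (auto simp: indices_def)
    have "z * 2 ^ (n + 1) + (2 * x + a) < Suc z * 2 ^ (n + 1)"
      using lt[OF p(2,3)] by simp
    also have "\<dots> \<le> 2 ^ w * 2 ^ (n + 1)"
      using p(1) by (intro mult_le_mono1) auto
    finally show "z * 2 ^ (n + 1) + (2 * x + a) < total_dim n w"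
      by (simp add: total_dim_def)
  qed
qed

lemma decode_in: "i < total_dim n w \<Longrightarrow> decode i \<in> indices"
  using bij_decode by (auto simp: bij_betw_def)

lemma decode_eq_iff:
  "i < total_dim n w \<Longrightarrow> j < total_dim n w \<Longrightarrow> decode i = decode j \<longleftrightarrow> i = j"
  using bij_decode by (auto simp: bij_betw_def inj_on_def)

lemma sum_decode:
  fixes f :: "nat \<times> nat \<times> nat \<Rightarrow> 'a :: comm_monoid_add"
  shows "(\<Sum>i<total_dim n w. f (decode i)) = sum f indices"
  by (rule sum.reindex_bij_betw[OF bij_decode])

lemma total_dim_pos: "total_dim n w > 0"
  by (simp add: total_dim_def)

lemma vec_of_carrier [simp]: "vec_of F \<in> carrier_vec (total_dim n w)"
  by (simp add: vec_of_def)

lemma mat_of_carrier [simp]: "mat_of G \<in> carrier_mat (total_dim n w) (total_dim n w)"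
  by (simp add: mat_of_def)

lemma vec_of_cong: "(\<And>p. p \<in> indices \<Longrightarrow> F p = F' p) \<Longrightarrow> vec_of F = vec_of F'"
  by (rule eq_vecI) (simp_all add: vec_of_def decode_in)

lemma unit_vec_0: "unit_vec (total_dim n w) 0 = vec_of (\<lambda>p. if p = (0, 0, 0) then 1 else 0)"
proof -
  have "decode 0 = (0, 0, 0)" by (simp add: decode_def)
  then have "decode i = (0, 0, 0) \<longleftrightarrow> i = 0" if "i < total_dim n w" for i
    using decode_eq_iff[OF that total_dim_pos] by simp
  then show ?thesis by (auto simp: vec_of_def intro!: eq_vecI)
qed

lemma mat_of_mult_vec: "mat_of G *\<^sub>v vec_of F = vec_of (\<lambda>p. \<Sum>q\<in>indices. G p q * F q)"
  by (auto simp: mat_of_def vec_of_def scalar_prod_def atLeast0LessThan sum_decode[of "\<lambda>q. G _ q * F q"]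
      intro!: eq_vecI)

lemma mat_of_mult: "mat_of G * mat_of G' = mat_of (\<lambda>p q. \<Sum>r\<in>indices. G p r * G' r q)"
  by (auto simp: mat_of_def scalar_prod_def atLeast0LessThan sum_decode[of "\<lambda>r. G _ r * G' r _"]
      intro!: eq_matI)

lemma mat_of_add: "mat_of G + mat_of G' = mat_of (\<lambda>p q. G p q + G' p q)"
  by (auto simp: mat_of_def intro!: eq_matI)

lemma mat_of_adjoint: "mat_adjoint (mat_of G) = mat_of (\<lambda>p q. cnj (G q p))"
  by (auto simp: mat_of_def mat_adjoint_def mat_of_rows_index intro!: eq_matI)

lemma mat_of_cong:
  "(\<And>p q. p \<in> indices \<Longrightarrow> q \<in> indices \<Longrightarrow> G p q = G' p q) \<Longrightarrow> mat_of G = mat_of G'"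
  by (rule eq_matI) (simp_all add: mat_of_def decode_in)

lemma mat_of_one: "mat_of (\<lambda>p q. if p = q then 1 else 0) = 1\<^sub>m (total_dim n w)"
  by (auto simp: mat_of_def decode_eq_iff intro!: eq_matI)

lemma mat_of_zero: "mat_of (\<lambda>p q. 0) = 0\<^sub>m (total_dim n w) (total_dim n w)"
  by (auto simp: mat_of_def intro!: eq_matI)

lemma norm_squared_vec_of: "norm_squared (vec_of F) = (\<Sum>p\<in>indices. (cmod (F p))\<^sup>2)"
  by (simp add: norm_squared_def vec_of_def sum_decode[of "\<lambda>p. (cmod (F p))\<^sup>2"])

text \<open>All unitaries of the algorithm are Hermitian involutions.\<close>

lemma is_unitary_mat_of:
  assumes "\<And>p q. p \<in> indices \<Longrightarrow> q \<in> indices \<Longrightarrow> cnj (G q p) = G p q"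
    and "\<And>p r. p \<in> indices \<Longrightarrow> r \<in> indices \<Longrightarrow>
      (\<Sum>q\<in>indices. G p q * G q r) = (if p = r then 1 else 0)"
  shows "is_unitary (total_dim n w) (mat_of G)"
proof -
  have "mat_adjoint (mat_of G) = mat_of G"
    unfolding mat_of_adjoint by (rule mat_of_cong) (simp add: assms(1))
  moreover have "mat_of G * mat_of G = 1\<^sub>m (total_dim n w)"
    unfolding mat_of_mult mat_of_one[symmetric] by (rule mat_of_cong) (simp add: assms(2))
  ultimately show ?thesis by (simp add: is_unitary_def)
qed

section \<open>Signed permutations, inversion about the mean, reflections and queries\<close>

definition permutation_mat ::
  "(nat \<times> nat \<times> nat \<Rightarrow> nat \<times> nat \<times> nat) \<Rightarrow> (nat \<times> nat \<times> nat \<Rightarrow> complex) \<Rightarrow> complex mat" where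
  "permutation_mat \<pi> s = mat_of (\<lambda>p q. if q = \<pi> p then s p else 0)"

lemma permutation_mat_mult_vec:
  assumes "\<And>p. p \<in> indices \<Longrightarrow> \<pi> p \<in> indices"
  shows "permutation_mat \<pi> s *\<^sub>v vec_of F = vec_of (\<lambda>p. s p * F (\<pi> p))"
  unfolding permutation_mat_def mat_of_mult_vec
  by (rule vec_of_cong) (simp add: assms if_distrib[of "\<lambda>t. t * _"] cong: if_cong)

lemma is_unitary_permutation_mat:
  assumes "\<And>p. p \<in> indices \<Longrightarrow> \<pi> p \<in> indices" "\<And>p. p \<in> indices \<Longrightarrow> \<pi> (\<pi> p) = p"
    and "\<And>p. p \<in> indices \<Longrightarrow> s p \<in> {1, -1}" "\<And>p. p \<in> indices \<Longrightarrow> s (\<pi> p) = s p"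
  shows "is_unitary (total_dim n w) (permutation_mat \<pi> s)"
  unfolding permutation_mat_def
proof (rule is_unitary_mat_of, goal_cases)
  case (1 p q)
  then show ?case using assms(2-4)[of p] assms(2-4)[of q] by auto
next
  case (2 p r)
  then show ?case using assms(1-4)[of p]
    by (auto simp: if_distrib[of "\<lambda>t. t * _"] cong: if_cong)
qed

text \<open>This is \<open>2|\<psi>\<rangle>\<langle>\<psi>| - I\<close> on the query-input
  register, tensored with the identity on the other two.\<close>

definition diffusion :: "nat \<times> nat \<times> nat \<Rightarrow> nat \<times> nat \<times> nat \<Rightarrow> complex" where
  "diffusion = (\<lambda>(z, x, a) (z', x', a').
     if z = z' \<and> a = a' then 2 / 2 ^ n - (if x = x' then 1 else 0) else 0)"

lemma diffusion_sum:
  assumes "(z, x, a) \<in> indices"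
  shows "(\<Sum>q\<in>indices. diffusion (z, x, a) q * F q) =
    2 / 2 ^ n * (\<Sum>x'<2 ^ n. F (z, x', a)) - F (z, x, a)"
proof -
  define E where "E x' = (2 / 2 ^ n - (if x = x' then 1 else 0)) * F (z, x', a)" for x'
  have "(\<Sum>q\<in>indices. diffusion (z, x, a) q * F q) =
      (\<Sum>z'<2 ^ w. \<Sum>x'<2 ^ n. \<Sum>a'<2. if a' = a then if z' = z then E x' else 0 else 0)"
    unfolding sum_indices by (intro sum.cong refl) (auto simp: diffusion_def E_def)
  also have "\<dots> = (\<Sum>x'<2 ^ n. \<Sum>z'<2 ^ w. if z' = z then E x' else 0)"
    using assms by (subst sum.swap) (simp add: indices_def)
  also have "\<dots> = (\<Sum>x'<2 ^ n. E x')"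
    using assms by (simp add: indices_def)
  also have "\<dots> = (\<Sum>x'<2 ^ n. 2 / 2 ^ n * F (z, x', a) - (if x' = x then F (z, x', a) else 0))"
    by (intro sum.cong refl) (auto simp: E_def algebra_simps)
  also have "\<dots> = 2 / 2 ^ n * (\<Sum>x'<2 ^ n. F (z, x', a)) - F (z, x, a)"
    using assms by (simp add: sum_subtractf sum_distrib_left indices_def)
  finally show ?thesis .
qed

lemma diffusion_mult_vec:
  "mat_of diffusion *\<^sub>v vec_of F =
    vec_of (\<lambda>(z, x, a). 2 / 2 ^ n * (\<Sum>x'<2 ^ n. F (z, x', a)) - F (z, x, a))"
  unfolding mat_of_mult_vec by (rule vec_of_cong) (auto simp: diffusion_sum)

lemma is_unitary_diffusion: "is_unitary (total_dim n w) (mat_of diffusion)"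
proof (rule is_unitary_mat_of, goal_cases)
  case (1 p q)
  then show ?case by (cases p; cases q) (auto simp: diffusion_def)
next
  case (2 p r)
  obtain z x a where p: "p = (z, x, a)" by (cases p)
  obtain z' x' a' where r: "r = (z', x', a')" by (cases r)
  have "x' < 2 ^ n" using 2 r by (auto simp: indices_def)
  \<comment> \<open>A column of the reflection sums to \<open>2 - 1 = 1\<close>, so by
    \<open>diffusion_sum\<close> the square has entries \<open>2 / 2 ^ n - diffusion\<close> within
    a block, which is the identity.\<close>
  then have "(\<Sum>x''<2 ^ n. diffusion (z, x'', a) r) = (if z = z' \<and> a = a' then 1 else 0)"
    by (auto simp: r diffusion_def sum_subtractf)
  then show ?case
    using 2 unfolding p diffusion_sum[of z x a "\<lambda>q. diffusion q r", OF 2(1)[unfolded p]]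
    by (auto simp: r diffusion_def)
qed

text \<open>The reflection in the hyperplane orthogonal to \<open>v\<close>. If \<open>v\<close>
  vanishes on \<open>indices\<close>, division by zero gives \<open>0\<close> and the matrix is the
  identity, as wanted when the target state is already the initial one.\<close>

definition householder :: "(nat \<times> nat \<times> nat \<Rightarrow> real) \<Rightarrow> complex mat" where
  "householder v = mat_of (\<lambda>p q. of_real
     ((if p = q then 1 else 0) - 2 / (\<Sum>r\<in>indices. (v r)\<^sup>2) * v p * v q))"

lemma is_unitary_householder: "is_unitary (total_dim n w) (householder v)"
  unfolding householder_def
proof (rule is_unitary_mat_of, goal_cases)
  case (1 p q)
  then show ?case by simp
next
  case (2 p r)
  define S where "S = (\<Sum>r\<in>indices. (v r)\<^sup>2)"
  have "(\<Sum>q\<in>indices. ((if p = q then 1 else 0) - 2 / S * v p * v q) *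
      ((if q = r then 1 else 0) - 2 / S * v q * v r)) =
    (\<Sum>q\<in>indices. (if p = q then if q = r then 1 else 0 else 0) -
       (if p = q then 2 / S * v q * v r else 0) - (if q = r then 2 / S * v p * v q else 0) +
       (v q)\<^sup>2 * (4 / S\<^sup>2 * v p * v r))"
    by (intro sum.cong refl) (auto simp: algebra_simps power2_eq_square)
  also have "\<dots> = (if p = r then 1 else 0) - 4 / S * v p * v r + S * (4 / S\<^sup>2 * v p * v r)"
    unfolding sum.distrib sum_subtractf sum_distrib_right[symmetric] S_def[symmetric]
    using 2 by simp
  also have "\<dots> = (if p = r then 1 else 0)"
    by (cases "S = 0") (auto simp: power2_eq_square)
  finally show ?case
    unfolding S_def[symmetric] of_real_mult[symmetric] of_real_sum[symmetric] by simp
qed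

text \<open>Two real unit vectors are exchanged by the reflection along their difference
  \<open>v\<close>: its squared norm \<open>S\<close> is twice its component at the origin, so
  exactly \<open>v\<close> is subtracted. This prepares the initial superposition.\<close>

lemma householder_unit_vec:
  assumes "(\<Sum>p\<in>indices. (F p)\<^sup>2) = 1"
  shows "householder (\<lambda>p. (if p = (0, 0, 0) then 1 else 0) - F p) *\<^sub>v unit_vec (total_dim n w) 0 =
    vec_of (\<lambda>p. of_real (F p))"
proof -
  define origin where "origin = (0 :: nat, 0 :: nat, 0 :: nat)"
  define v where "v p = (if p = origin then 1 else 0) - F p" for p
  define S where "S = (\<Sum>p\<in>indices. (v p)\<^sup>2)"
  have origin: "origin \<in> indices" by (simp add: origin_def indices_def)
  have "S = (\<Sum>p\<in>indices. (if p = origin then 1 - 2 * F p else 0) + (F p)\<^sup>2)"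
    unfolding S_def v_def by (intro sum.cong refl) (auto simp: power2_eq_square algebra_simps)
  also have "\<dots> = 2 * v origin"
    using origin by (simp add: sum.distrib assms v_def)
  finally have S: "S = 2 * v origin" .
  have zero: "v p = 0" if "S = 0" "p \<in> indices" for p
    using that by (simp add: S_def sum_nonneg_eq_0_iff)
  have "(\<Sum>q\<in>indices. complex_of_real ((if p = q then 1 else 0) - 2 / S * v p * v q) *
      (if q = origin then 1 else 0)) = of_real (F p)" if p: "p \<in> indices" for p
  proof -
    have "(\<Sum>q\<in>indices. complex_of_real ((if p = q then 1 else 0) - 2 / S * v p * v q) *
      (if q = origin then 1 else 0)) = of_real ((if p = origin then 1 else 0) - 2 / S * v p * v origin)"
      using origin by (simp add: if_distrib[of "\<lambda>t. _ * t"] cong: if_cong)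
    also have "2 / S * v p * v origin = v p"
      using S zero[OF _ p] by (cases "S = 0") auto
    also have "(if p = origin then 1 else 0) - v p = F p"
      by (simp add: v_def)
    finally show ?thesis .
  qed
  then show ?thesis
    unfolding householder_def unit_vec_0 mat_of_mult_vec
    unfolding origin_def[symmetric] v_def[symmetric] S_def[symmetric]
    by (intro vec_of_cong) simp
qed

lemma query_mult_vec:
  assumes h: "h \<in> sign_functions n"
  shows "lift_query w None (oracle_unitary n h) *\<^sub>v vec_of F =
    vec_of (\<lambda>(z, x, a). F (z, x, if h x = 1 then a else 1 - a))"
proof -
  define \<pi> where "\<pi> = (\<lambda>(z :: nat, x, a :: nat). (z, x, if h x = 1 then a else 1 - a))"
  have "lift_query w None (oracle_unitary n h) = permutation_mat \<pi> (\<lambda>_. 1)"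
  proof (rule eq_matI)
    fix i j assume "i < dim_row (permutation_mat \<pi> (\<lambda>_. 1))" "j < dim_col (permutation_mat \<pi> (\<lambda>_. 1))"
    then have ij: "i < total_dim n w" "j < total_dim n w"
      by (auto simp: permutation_mat_def mat_of_def)
    let ?B = "2 ^ (n + 1) :: nat"
    define z x a where "z = i div ?B" and "x = i mod ?B div 2" and "a = i mod ?B mod 2"
    define z' x' a' where "z' = j div ?B" and "x' = j mod ?B div 2" and "a' = j mod ?B mod 2"
    have dec: "decode i = (z, x, a)" "decode j = (z', x', a')"
      by (simp_all add: decode_def z_def x_def a_def z'_def x'_def a'_def)
    have lt: "x' < 2 ^ n" "a < 2" "a' < 2"
      using decode_in[OF ij(1)] decode_in[OF ij(2)] by (auto simp: dec indices_def)
    have i: "i mod ?B = 2 * x + a"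
      by (simp add: x_def a_def del: power_Suc)
    have "h x' = 1 \<or> h x' = -1" using h lt by (auto simp: sign_functions_def)
    \<comment> \<open>The oracle matrix is given by columns, \<open>permutation_mat\<close> by rows.
      Flipping the target is an involution, so the condition can be solved for
      \<open>a'\<close>.\<close>
    then have iff: "2 * x + a = 2 * x' + xor a' (nat ((1 - h x') div 2)) \<longleftrightarrow>
        x' = x \<and> a' = (if h x = 1 then a else 1 - a)"
      using lt by (auto simp: less_2_cases_iff) presburger+
    have dim: "dim_row (oracle_unitary n h) = ?B"
      by (simp add: oracle_unitary_def)
    have "lift_query w None (oracle_unitary n h) $$ (i, j) =
        (if z = z' then oracle_unitary n h $$ (i mod ?B, j mod ?B) else 0)"
      using ij unfolding lift_query_def Let_def dim total_dim_def z_def z'_def by (subst index_mat) auto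
    also have "oracle_unitary n h $$ (i mod ?B, j mod ?B) =
        (if i mod ?B = 2 * x' + xor a' (nat ((1 - h x') div 2)) then 1 else 0)"
      unfolding oracle_unitary_def x'_def a'_def Let_def by (subst index_mat) auto
    also have "(if z = z' then \<dots> else 0) = permutation_mat \<pi> (\<lambda>_. 1) $$ (i, j)"
      using ij unfolding i iff by (auto simp: permutation_mat_def mat_of_def dec \<pi>_def)
    finally show "lift_query w None (oracle_unitary n h) $$ (i, j) =
      permutation_mat \<pi> (\<lambda>_. 1) $$ (i, j)" .
  qed (simp_all add: Let_def lift_query_def oracle_unitary_def permutation_mat_def mat_of_def total_dim_def)
  moreover have "\<pi> p \<in> indices" if "p \<in> indices" for p
    using that by (auto simp: \<pi>_def indices_def)
  ultimately show ?thesis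
    using permutation_mat_mult_vec[of \<pi> "\<lambda>_. 1" F] by (simp add: \<pi>_def case_prod_unfold)
qed

section \<open>Measuring the control register in the Fourier basis\<close>

text \<open>
  The outcome \<open>k\<close> stands for the Fourier basis vector \<open>k div J\<close> together with a uniformly
  random number \<open>k mod J\<close>.
\<close>

definition fourier_op :: "nat \<Rightarrow> nat \<Rightarrow> complex mat" where
  "fourier_op J j = mat_of (\<lambda>p q. if p = (0, snd q)
     then cnj (root_unity (2 ^ w) j) ^ fst q / of_real (sqrt (2 ^ w * real J)) else 0)"

definition fourier_ops :: "nat \<Rightarrow> complex mat list" where
  "fourier_ops J = map (\<lambda>k. fourier_op J (k div J)) [0..<2 ^ w * J]"

text \<open>The operator sends the \<open>j\<close>-th Fourier vector of the control register to
  \<open>|0\<rangle>\<close> and keeps the other registers, scaled by \<open>1 / sqrt J\<close>. Its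
  Gram matrix is therefore the Fourier projector divided by \<open>J\<close>.\<close>

lemma fourier_op_gram:
  "mat_adjoint (fourier_op J j) * fourier_op J j = mat_of (\<lambda>p q. if snd p = snd q
     then root_unity (2 ^ w) j ^ fst p * cnj (root_unity (2 ^ w) j ^ fst q) / (2 ^ w * of_nat J)
     else 0)"
  unfolding fourier_op_def mat_of_adjoint mat_of_mult
proof (rule mat_of_cong, goal_cases)
  case (1 p q)
  let ?\<omega> = "root_unity (2 ^ w) j" and ?s = "complex_of_real (sqrt (2 ^ w * real J))"
  have in0: "(0, snd p) \<in> indices" using 1 by (auto simp: indices_def)
  have s: "?s * ?s = 2 ^ w * of_nat J"
    unfolding of_real_mult[symmetric] by simp
  have "(\<Sum>r\<in>indices. cnj (if r = (0, snd p) then cnj ?\<omega> ^ fst p / ?s else 0) *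
      (if r = (0, snd q) then cnj ?\<omega> ^ fst q / ?s else 0)) =
      (\<Sum>r\<in>indices. if r = (0, snd p) then if snd p = snd q
         then ?\<omega> ^ fst p / ?s * (cnj ?\<omega> ^ fst q / ?s) else 0 else 0)"
    by (intro sum.cong refl) auto
  also have "\<dots> = (if snd p = snd q then ?\<omega> ^ fst p / ?s * (cnj ?\<omega> ^ fst q / ?s) else 0)"
    using in0 by simp
  finally show ?case by (simp add: s)
qed

lemma is_measurement_fourier_ops:
  assumes J: "J > 0"
  shows "is_measurement (total_dim n w) (fourier_ops J)"
proof -
  define H where "H j p q = (if snd p = snd q
     then root_unity (2 ^ w) j ^ fst p * cnj (root_unity (2 ^ w) j ^ fst q) / (2 ^ w * of_nat J)
     else 0)" for j and p q :: "nat \<times> nat \<times> nat"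
  have "foldr (\<lambda>M S. mat_adjoint M * M + S) (map (\<lambda>k. fourier_op J (k div J)) ks)
      (0\<^sub>m (total_dim n w) (total_dim n w)) = mat_of (\<lambda>p q. \<Sum>k\<leftarrow>ks. H (k div J) p q)" for ks
    by (induction ks) (simp_all add: mat_of_zero fourier_op_gram mat_of_add flip: H_def)
  then have "foldr (\<lambda>M S. mat_adjoint M * M + S) (fourier_ops J)
      (0\<^sub>m (total_dim n w) (total_dim n w)) = mat_of (\<lambda>p q. \<Sum>k\<leftarrow>[0..<2 ^ w * J]. H (k div J) p q)"
    by (simp add: fourier_ops_def)
  also have "\<dots> = 1\<^sub>m (total_dim n w)"
    unfolding mat_of_one[symmetric]
  proof (rule mat_of_cong)
    fix p q assume pq: "p \<in> indices" "q \<in> indices"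
    then have lt: "fst p < 2 ^ w" "fst q < 2 ^ w" by (auto simp: indices_def)
    have "(\<Sum>k\<leftarrow>[0..<2 ^ w * J]. H (k div J) p q) = (\<Sum>k<2 ^ w * J. H (k div J) p q)"
      by (simp add: interv_sum_list_conv_sum_set_nat atLeast0LessThan)
    \<comment> \<open>Each \<open>j\<close> occurs for \<open>J\<close> outcomes, which cancels the
      factor \<open>1 / J\<close>; orthogonality of the roots of unity then gives
      completeness.\<close>
    also have "\<dots> = of_nat J * (\<Sum>j<2 ^ w. H j p q)"
      using sum_div_mod[OF J, of "\<lambda>j s. H j p q"] by (simp add: sum_distrib_left)
    also have "\<dots> = (if p = q then 1 else 0)"
    proof (cases "snd p = snd q")
      case True
      have "of_nat J * (\<Sum>j<2 ^ w. H j p q) = of_nat J * ((\<Sum>j<2 ^ w.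
          root_unity (2 ^ w) j ^ fst p * cnj (root_unity (2 ^ w) j ^ fst q)) / (2 ^ w * of_nat J))"
        by (simp add: H_def True sum_divide_distrib)
      also have "\<dots> = (if p = q then 1 else 0)"
        unfolding sum_root_unity_powers[OF lt] using J True by (auto simp: prod_eq_iff)
      finally show ?thesis .
    next
      case False
      then show ?thesis by (auto simp: H_def)
    qed
    finally show "(\<Sum>k\<leftarrow>[0..<2 ^ w * J]. H (k div J) p q) = (if p = q then 1 else 0)" .
  qed
  finally show ?thesis
    by (auto simp: is_measurement_def fourier_ops_def fourier_op_def)
qed

lemma norm_squared_fourier_op:
  "norm_squared (fourier_op J j *\<^sub>v vec_of F) =
    (\<Sum>x<2 ^ n. \<Sum>a<2. (cmod (\<Sum>z<2 ^ w. cnj (root_unity (2 ^ w) j) ^ z * F (z, x, a)))\<^sup>2) /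
      (2 ^ w * real J)"
proof -
  let ?\<omega> = "root_unity (2 ^ w) j" and ?s = "complex_of_real (sqrt (2 ^ w * real J))"
  have "(\<Sum>q\<in>indices. (if p = (0, snd q) then cnj ?\<omega> ^ fst q / ?s else 0) * F q) =
      (if fst p = 0 then (\<Sum>z<2 ^ w. cnj ?\<omega> ^ z * F (z, snd p)) / ?s else 0)"
    if p: "p \<in> indices" for p
  proof -
    obtain z0 x0 a0 where p': "p = (z0, x0, a0)" by (cases p)
    have "(\<Sum>q\<in>indices. (if p = (0, snd q) then cnj ?\<omega> ^ fst q / ?s else 0) * F q) =
        (\<Sum>z<2 ^ w. \<Sum>x<2 ^ n. \<Sum>a<2. if a = a0
           then if x = x0 then if z0 = 0 then cnj ?\<omega> ^ z / ?s * F (z, x0, a0) else 0 else 0 else 0)"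
      unfolding sum_indices by (intro sum.cong refl) (auto simp: p')
    also have "\<dots> = (\<Sum>z<2 ^ w. if z0 = 0 then cnj ?\<omega> ^ z / ?s * F (z, x0, a0) else 0)"
      using p by (simp add: p' indices_def)
    finally show ?thesis by (simp add: p' sum_divide_distrib)
  qed
  then have "norm_squared (fourier_op J j *\<^sub>v vec_of F) = (\<Sum>p\<in>indices.
      (cmod (if fst p = 0 then (\<Sum>z<2 ^ w. cnj ?\<omega> ^ z * F (z, snd p)) / ?s else 0))\<^sup>2)"
    unfolding fourier_op_def mat_of_mult_vec norm_squared_vec_of by (intro sum.cong) auto
  also have "\<dots> = (\<Sum>z'::nat<2 ^ w. if z' = 0 then \<Sum>x<2 ^ n. \<Sum>a<2.
      (cmod ((\<Sum>z<2 ^ w. cnj ?\<omega> ^ z * F (z, x, a)) / ?s))\<^sup>2 else 0)"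
    unfolding sum_indices by (intro sum.cong refl) auto
  also have "\<dots> = (\<Sum>x<2 ^ n. \<Sum>a<2. (cmod ((\<Sum>z<2 ^ w. cnj ?\<omega> ^ z * F (z, x, a)) / ?s))\<^sup>2)"
    by simp
  also have "\<dots> = (\<Sum>x<2 ^ n. \<Sum>a<2. (cmod (\<Sum>z<2 ^ w. cnj ?\<omega> ^ z * F (z, x, a)))\<^sup>2) /
      (2 ^ w * real J)"
  proof -
    have scale: "(cmod (v / ?s))\<^sup>2 = (cmod v)\<^sup>2 / (2 ^ w * real J)" for v
      by (simp add: norm_divide power_divide)
    show ?thesis
      unfolding scale by (simp only: sum_divide_distrib)
  qed
  finally show ?thesis .
qed

lemma prob_measure_fourier:
  assumes J: "J > 0" and F: "norm_squared (vec_of F) = 1"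
  shows "measure_pmf.prob (run n w h (Measure (fourier_ops J) (\<lambda>k. Output (r k))) (vec_of F)) S =
    (\<Sum>k | k < 2 ^ w * J \<and> r k \<in> S. norm_squared (fourier_op J (k div J) *\<^sub>v vec_of F))"
proof -
  let ?P = "outcome_pmf (fourier_ops J) (vec_of F)"
  have len: "length (fourier_ops J) = 2 ^ w * J" by (simp add: fourier_ops_def)
  have pmf: "pmf ?P k = (if k < 2 ^ w * J then norm_squared (fourier_op J (k div J) *\<^sub>v vec_of F) else 0)"
    for k
    unfolding pmf_outcome[OF is_measurement_fourier_ops[OF J] vec_of_carrier F] len
    by (simp add: fourier_ops_def)
  have "run n w h (Measure (fourier_ops J) (\<lambda>k. Output (r k))) (vec_of F) = map_pmf r ?P"
    by (simp add: map_pmf_def)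
  then have "measure_pmf.prob (run n w h (Measure (fourier_ops J) (\<lambda>k. Output (r k))) (vec_of F)) S =
      measure_pmf.prob ?P (r -` S)"
    by simp
  also have "\<dots> = measure_pmf.prob ?P {k. k < 2 ^ w * J \<and> r k \<in> S}"
    by (rule measure_prob_cong_0) (auto simp: pmf)
  also have "\<dots> = (\<Sum>k | k < 2 ^ w * J \<and> r k \<in> S. pmf ?P k)"
    by (rule measure_measure_pmf_finite) simp
  also have "\<dots> = (\<Sum>k | k < 2 ^ w * J \<and> r k \<in> S. norm_squared (fourier_op J (k div J) *\<^sub>v vec_of F))"
    by (intro sum.cong) (auto simp: pmf)
  finally show ?thesis .
qed

section \<open>The algorithm\<close>

text \<open>Conjugating a query to \<open>g\<close> by this involution gives access to
  \<open>g (xor x y)\<close>.\<close>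

definition shift_mat :: "nat \<Rightarrow> complex mat" where
  "shift_mat y = permutation_mat (\<lambda>(z, x, b). (z, xor x y, b)) (\<lambda>_. 1)"

text \<open>A query acts trivially on the target state \<open>|0\<rangle> + |1\<rangle>\<close> and as a phase on \<open>|0\<rangle> - |1\<rangle>\<close>.\<close>

definition activate_mat :: "nat \<Rightarrow> complex mat" where
  "activate_mat k = permutation_mat (\<lambda>p. p) (\<lambda>(z, x, b). if z = k \<and> b = 1 then - 1 else 1)"

lemma xor_less: "x < 2 ^ n \<Longrightarrow> y < 2 ^ n \<Longrightarrow> xor x y < (2 :: nat) ^ n"
  by (simp flip: take_bit_nat_eq_self_iff)

lemma xor_xor: "xor (xor x y) y = (x :: nat)"
  by (simp add: xor.assoc)

lemma is_unitary_shift: "y < 2 ^ n \<Longrightarrow> is_unitary (total_dim n w) (shift_mat y)"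
  unfolding shift_mat_def
  by (rule is_unitary_permutation_mat) (auto simp: indices_def xor_less xor_xor)

lemma is_unitary_activate: "is_unitary (total_dim n w) (activate_mat k)"
  unfolding activate_mat_def by (rule is_unitary_permutation_mat) auto

lemma shift_mult_vec:
  assumes "y < 2 ^ n"
  shows "shift_mat y *\<^sub>v vec_of F = vec_of (\<lambda>(z, x, b). F (z, xor x y, b))"
proof -
  have "shift_mat y *\<^sub>v vec_of F = vec_of (\<lambda>p. 1 * F (case p of (z, x, b) \<Rightarrow> (z, xor x y, b)))"
    unfolding shift_mat_def
    by (rule permutation_mat_mult_vec) (auto simp: indices_def xor_less assms)
  then show ?thesis by (simp add: case_prod_unfold)
qed

lemma activate_mult_vec:
  "activate_mat k *\<^sub>v vec_of F =
    vec_of (\<lambda>(z, x, b). (if z = k \<and> b = 1 then - 1 else 1) * F (z, x, b))"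
  using permutation_mat_mult_vec[of "\<lambda>p. p"]
  by (simp add: activate_mat_def case_prod_unfold)

text \<open>The two queries realise \<open>D\<close> on active components without any controlled
  query. Activating \<open>k\<close> comes last, so component \<open>k\<close> starts walking in the
  next step.\<close>

definition walk_step :: "nat \<Rightarrow> nat \<Rightarrow> query_algorithm \<Rightarrow> query_algorithm" where
  "walk_step y k B =
     Query Oracle_f False None (Unitary (shift_mat y)
    (Query Oracle_g False None (Unitary (shift_mat y)
    (Unitary (mat_of diffusion) (Unitary (activate_mat k) B)))))"

primrec walk_steps :: "nat \<Rightarrow> nat \<Rightarrow> nat \<Rightarrow> query_algorithm \<Rightarrow> query_algorithm" where
  "walk_steps y T 0 B = B"
\<comment> \<open>The new step is executed last. Step \<open>t\<close>, counted from
  \<open>0\<close>, activates \<open>T - Suc t\<close>, which is also the number of steps still to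
  come; component \<open>T\<close> is active from the start.\<close>
| "walk_steps y T (Suc t) B = walk_steps y T t (walk_step y (T - Suc t) B)"

lemma wf_walk_steps:
  "y < 2 ^ n \<Longrightarrow> wf_algorithm n w (walk_steps y T t B) \<longleftrightarrow> wf_algorithm n w B"
  by (induction t arbitrary: B)
     (simp_all add: walk_step_def is_unitary_shift is_unitary_activate is_unitary_diffusion)

lemma query_count_walk_steps: "query_count (walk_steps y T t B) = 2 * t + query_count B"
  by (induction t arbitrary: B) (simp_all add: walk_step_def)

text \<open>
  The state after \<open>t\<close> of \<open>T\<close> steps. Component \<open>z\<close> of the control register takes part only in the
  last \<open>z\<close> steps; before, both registers are fixed by the queries and the diffusion. The exponent
  \<open>z + t - T\<close> is a truncated subtraction.
\<close>

definition walk_state ::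
  "(nat \<Rightarrow> real) \<Rightarrow> nat \<Rightarrow> real \<Rightarrow> (nat \<Rightarrow> real) \<Rightarrow> nat \<Rightarrow> nat \<times> nat \<times> nat \<Rightarrow> real" where
  "walk_state a T c h t = (\<lambda>(z, x, b).
     a z * (fst (walk_coeffs c (z + t - T)) + h x * snd (walk_coeffs c (z + t - T))) / sqrt (2 * 2 ^ n) *
     (if T \<le> z + t \<and> b = 1 then - 1 else 1))"

text \<open>The random \<open>s < J\<close> selects one of \<open>J\<close> subintervals of length \<open>2 e\<close>.\<close>

definition estimate :: "nat \<Rightarrow> real \<Rightarrow> nat \<Rightarrow> nat \<Rightarrow> real" where
  "estimate J e j s = Re (root_unity (2 ^ w) j) + (2 * real s + 1 - real J) * e"

text \<open>The zeros passed for \<open>c\<close> and \<open>h\<close> are placeholders that keep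
  the preparation independent of the oracles: at time \<open>0\<close> the walk exponent is
  \<open>0\<close> for \<open>z \<le> T\<close>, and the amplitude vanishes for
  \<open>z > T\<close>.\<close>

definition walk_algorithm :: "(nat \<Rightarrow> real) \<Rightarrow> nat \<Rightarrow> nat \<Rightarrow> nat \<Rightarrow> real \<Rightarrow> query_algorithm" where
  "walk_algorithm a T y J e =
     Unitary (householder (\<lambda>p. (if p = (0, 0, 0) then 1 else 0) - walk_state a T 0 (\<lambda>_. 0) 0 p))
       (walk_steps y T T (Measure (fourier_ops J) (\<lambda>k. Output (estimate J e (k div J) (k mod J)))))"

lemma wf_walk_algorithm:
  "y < 2 ^ n \<Longrightarrow> J > 0 \<Longrightarrow> wf_algorithm n w (walk_algorithm a T y J e)"
  by (simp add: walk_algorithm_def is_unitary_householder wf_walk_steps is_measurement_fourier_ops)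

lemma query_count_walk_algorithm:
  assumes "J > 0"
  shows "query_count (walk_algorithm a T y J e) = 2 * T"
proof -
  have "(\<lambda>i. 0 :: nat) ` {..<length (fourier_ops J)} = {0}"
    using assms by (simp add: fourier_ops_def image_constant_conv lessThan_empty_iff)
  then show ?thesis
    by (simp add: walk_algorithm_def query_count_walk_steps)
qed

end

section \<open>Correctness for fixed oracle functions\<close>

locale walk = register +
  fixes f g :: "nat \<Rightarrow> int" and y T :: nat and a :: "nat \<Rightarrow> real"
  assumes y: "y < 2 ^ n" and f: "f \<in> sign_functions n" and g: "g \<in> sign_functions n"
    and T: "T < 2 ^ w" and a: "\<And>k. k > T \<Longrightarrow> a k = 0" "(\<Sum>k\<le>T. (a k)\<^sup>2) = 1"
begin

definition h :: "nat \<Rightarrow> real" where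
  "h x = of_int (f x * g (xor x y))"

definition c :: real where
  "c = of_int (cross_correlation n f g y) / 2 ^ n"

abbreviation state :: "nat \<Rightarrow> nat \<times> nat \<times> nat \<Rightarrow> real" where
  "state \<equiv> walk_state a T c h"

lemma sum_h: "(\<Sum>x<2 ^ n. h x) = c * 2 ^ n"
  by (simp add: c_def h_def cross_correlation_def)

lemma f_cases: "x < 2 ^ n \<Longrightarrow> f x = 1 \<or> f x = -1"
  using f by (auto simp: sign_functions_def)

lemma g_cases: "x < 2 ^ n \<Longrightarrow> g (xor x y) = 1 \<or> g (xor x y) = -1"
  using g xor_less[OF _ y] by (auto simp: sign_functions_def)

lemma h_cases: "x < 2 ^ n \<Longrightarrow> h x \<in> {1, -1}"
  using f_cases[of x] g_cases[of x] by (auto simp: h_def)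

lemma h_square: "x < 2 ^ n \<Longrightarrow> h x * (h x * u) = u"
  using h_cases[of x] by auto

lemma state_step:
  assumes t: "t < T" and p: "(z, x, b) \<in> indices"
  defines "flip \<equiv> \<lambda>x b. if f x = 1 then if g (xor x y) = 1 then b else 1 - b
     else 1 - (if g (xor x y) = 1 then b else 1 - b)"
  shows "(if z = T - Suc t \<and> b = 1 then - 1 else 1) *
      (2 / 2 ^ n * (\<Sum>x'<2 ^ n. state t (z, x', flip x' b)) - state t (z, x, flip x b)) =
    state (Suc t) (z, x, b)"
proof (cases "T \<le> z + t")
  case True
  then obtain k where k: "z + t = T + k" using le_Suc_ex by blast
  have b: "b = 0 \<or> b = 1" and x: "x < 2 ^ n" using p by (auto simp: indices_def)
  define r where "r = a z / sqrt (2 * 2 ^ n) * (if b = 1 then - 1 else 1)"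
  define P where "P = fst (walk_coeffs c k)"
  define R where "R = snd (walk_coeffs c k)"
  \<comment> \<open>The target state turns the two flips into the sign \<open>h x'\<close>; since
    \<open>h x'\<close> squares to \<open>1\<close>, this exchanges the roles of \<open>P\<close>
    and \<open>R\<close>.\<close>
  have st: "state t (z, x', flip x' b) = r * (h x' * P + R)" if "x' < 2 ^ n" for x'
  proof -
    have "state t (z, x', flip x' b) = h x' * (r * (P + h x' * R))"
      using f_cases[OF that] g_cases[OF that] b True k
      by (auto simp: walk_state_def flip_def r_def P_def R_def h_def)
    also have "\<dots> = r * (h x' * P + h x' * (h x' * R))" by (simp add: algebra_simps)
    finally show ?thesis using h_square[OF that] by simp
  qed
  have "(\<Sum>x'<2 ^ n. state t (z, x', flip x' b)) = (\<Sum>x'<2 ^ n. h x' * (r * P) + r * R)"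
    by (intro sum.cong refl) (auto simp: st algebra_simps)
  also have "\<dots> = r * (c * P + R) * 2 ^ n"
    unfolding sum.distrib sum_distrib_right[symmetric] sum_h by (simp add: algebra_simps)
  finally have "2 / 2 ^ n * (\<Sum>x'<2 ^ n. state t (z, x', flip x' b)) - state t (z, x, flip x b) =
      r * ((2 * c * P + R) - h x * P)"
    using st[OF x] by (simp add: algebra_simps)
  also have "(if z = T - Suc t \<and> b = 1 then - 1 else 1) * \<dots> = state (Suc t) (z, x, b)"
    using True k t by (auto simp: walk_state_def P_def R_def r_def)
  finally show ?thesis by simp
next
  case False
  \<comment> \<open>An inactive component is constant in \<open>x'\<close> and \<open>b'\<close>,
    hence fixed by the flips and by inversion about the mean; only a possible activation sign
    remains.\<close>
  then have "state t (z, x', b') = a z / sqrt (2 * 2 ^ n)" for x' b'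
    by (simp add: walk_state_def)
  moreover have "state (Suc t) (z, x, b) =
      (if z = T - Suc t \<and> b = 1 then - 1 else 1) * (a z / sqrt (2 * 2 ^ n))"
    using False t by (auto simp: walk_state_def)
  ultimately show ?thesis by simp
qed

lemma run_walk_step:
  assumes "t < T"
  shows "run n w (case_oracle_name f g) (walk_step y (T - Suc t) B) (vec_of (\<lambda>p. of_real (state t p))) =
    run n w (case_oracle_name f g) B (vec_of (\<lambda>p. of_real (state (Suc t) p)))"
proof -
  define flip where "flip = (\<lambda>x (b :: nat). if f x = 1 then if g (xor x y) = 1 then b else 1 - b
     else 1 - (if g (xor x y) = 1 then b else 1 - b))"
  define \<sigma> where "\<sigma> z b = (if z = T - Suc t \<and> b = (1 :: nat) then - 1 else 1 :: real)" for z b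
  let ?F = "\<lambda>p. complex_of_real (state t p)"
  have "run n w (case_oracle_name f g) (walk_step y (T - Suc t) B) (vec_of ?F) =
    run n w (case_oracle_name f g) B (vec_of (\<lambda>(z, x, b). of_real (\<sigma> z b) *
      (2 / 2 ^ n * (\<Sum>x'<2 ^ n. ?F (z, x', flip x' b)) - ?F (z, x, flip x b))))"
  proof -
    have g_query: "shift_mat y *\<^sub>v (lift_query w None (oracle_unitary n g) *\<^sub>v
        (shift_mat y *\<^sub>v vec_of F)) =
        vec_of (\<lambda>(z, x, b). F (z, x, if g (xor x y) = 1 then b else 1 - b))" for F
      by (simp add: shift_mult_vec[OF y] query_mult_vec[OF g] xor_xor case_prod_unfold cong: if_cong)
    have f_query: "lift_query w None (oracle_unitary n f) *\<^sub>v vec_of ?F =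
        vec_of (\<lambda>(z, x, b). ?F (z, x, if f x = 1 then b else 1 - b))"
      by (rule query_mult_vec[OF f])
    have fl: "(if f x = 1 then if g (xor x y) = 1 then b else 1 - b
        else 1 - (if g (xor x y) = 1 then b else 1 - b)) = flip x b" for x b
      by (simp add: flip_def)
    have \<sigma>: "(if z = T - Suc t \<and> b = 1 then - 1 else 1) = complex_of_real (\<sigma> z b)" for z b
      by (simp add: \<sigma>_def)
    show ?thesis
      by (simp only: walk_step_def run.simps Let_def oracle_name.case if_False f_query g_query
          diffusion_mult_vec activate_mult_vec prod.case fl \<sigma>)
  qed
  also have "vec_of (\<lambda>(z, x, b). of_real (\<sigma> z b) *
      (2 / 2 ^ n * (\<Sum>x'<2 ^ n. ?F (z, x', flip x' b)) - ?F (z, x, flip x b))) =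
    vec_of (\<lambda>p. of_real (state (Suc t) p))"
  proof (rule vec_of_cong, clarify)
    fix z x b assume p: "(z, x, b) \<in> indices"
    show "complex_of_real (\<sigma> z b) *
      (2 / 2 ^ n * (\<Sum>x'<2 ^ n. ?F (z, x', flip x' b)) - ?F (z, x, flip x b)) =
      of_real (state (Suc t) (z, x, b))"
      unfolding state_step[OF assms p, symmetric] by (simp add: \<sigma>_def flip_def)
  qed
  finally show ?thesis .
qed

lemma run_walk_steps:
  "t \<le> T \<Longrightarrow> run n w (case_oracle_name f g) (walk_steps y T t B) (vec_of (\<lambda>p. of_real (state 0 p))) =
    run n w (case_oracle_name f g) B (vec_of (\<lambda>p. of_real (state t p)))"
  by (induction t arbitrary: B) (simp_all add: run_walk_step)

abbreviation Q :: nat where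
  "Q \<equiv> 2 ^ w"

text \<open>\<open>Q\<close> times the probability of outcome \<open>j\<close> in phase estimation
  with exact eigenvalue \<open>z\<close>.\<close>

definition phase_weight :: "complex \<Rightarrow> nat \<Rightarrow> real" where
  "phase_weight z j = (cmod (\<Sum>k<Q. cnj (root_unity Q j) ^ k * (of_real (a k) * z ^ k)))\<^sup>2"

lemma sum_a: "(\<Sum>k<Q. (a k)\<^sup>2) = 1"
proof -
  have "(\<Sum>k<Q. (a k)\<^sup>2) = (\<Sum>k\<le>T. (a k)\<^sup>2)"
    using T a(1) by (intro sum.mono_neutral_right) auto
  then show ?thesis by (simp add: a)
qed

lemma sum_phase_weight: "cmod z = 1 \<Longrightarrow> (\<Sum>j<Q. phase_weight z j) = Q"
  unfolding phase_weight_def Parseval_root_unity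
  by (simp add: norm_mult norm_power power_mult_distrib sum_a)

text \<open>The measurement sees an equal mixture of phase estimations for \<open>z\<close> and
  \<open>cnj z\<close>. At time \<open>T\<close> every component is active with walk exponent
  \<open>k\<close>, and the target sign is common to all \<open>k\<close>, so it drops out of the
  modulus.\<close>

lemma norm_squared_fourier_state:
  assumes z: "cmod z = 1" "Re z = c"
  shows "norm_squared (fourier_op J j *\<^sub>v vec_of (\<lambda>p. of_real (state T p))) =
    (phase_weight z j + phase_weight (cnj z) j) / 2 / (Q * real J)"
proof -
  define u where "u k = cnj (root_unity Q j) ^ k * of_real (a k)" for k
  define V where "V x = (\<Sum>k<Q. u k * of_real (fst (walk_coeffs (Re z) k) + h x * snd (walk_coeffs (Re z) k)))" for x
  have component: "(cmod (\<Sum>k<Q. cnj (root_unity Q j) ^ k * of_real (state T (k, x, b))))\<^sup>2 =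
      (cmod (V x))\<^sup>2 / (2 * 2 ^ n)" for x b
  proof -
    define s :: real where "s = (if b = 1 then - 1 else 1) / sqrt (2 * 2 ^ n)"
    have "(\<Sum>k<Q. cnj (root_unity Q j) ^ k * of_real (state T (k, x, b))) = V x * of_real s"
      unfolding V_def sum_distrib_right
      by (intro sum.cong refl) (simp add: walk_state_def u_def s_def z)
    moreover have "s\<^sup>2 = 1 / (2 * 2 ^ n)" by (simp add: s_def power_divide)
    ultimately show ?thesis
      by (simp add: norm_mult power_mult_distrib)
  qed
  have "(\<Sum>x<2 ^ n. \<Sum>b<2. (cmod (\<Sum>k<Q. cnj (root_unity Q j) ^ k * of_real (state T (k, x, b))))\<^sup>2) =
      (\<Sum>x<2 ^ n. (cmod (V x))\<^sup>2) / 2 ^ n"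
    unfolding component by (simp add: sum_divide_distrib)
  also have "(\<Sum>x<2 ^ n. (cmod (V x))\<^sup>2) = 2 ^ n *
      (((cmod (\<Sum>k<Q. u k * z ^ k))\<^sup>2 + (cmod (\<Sum>k<Q. u k * cnj z ^ k))\<^sup>2) / 2)"
    using norm_square_walk_combination[OF z(1), of "2 ^ n" h u "{..<Q}"] h_cases sum_h z(2)
    by (simp add: V_def)
  also have "\<dots> / 2 ^ n = (phase_weight z j + phase_weight (cnj z) j) / 2"
    by (simp add: phase_weight_def u_def mult.assoc)
  finally show ?thesis
    unfolding norm_squared_fourier_op by (simp only: of_nat_power of_nat_numeral)
qed

lemma abs_c_le: "\<bar>c\<bar> \<le> 1"
proof -
  have "\<bar>\<Sum>x<2 ^ n. h x\<bar> \<le> (\<Sum>x::nat<2 ^ n. 1 :: real)"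
    by (rule order.trans[OF sum_abs], rule sum_mono) (use h_cases in force)
  then show ?thesis by (simp add: sum_h abs_mult)
qed

lemma phase_exists:
  obtains z where "cmod z = 1" "Re z = c"
proof
  show "cmod (Complex c (sqrt (1 - c\<^sup>2))) = 1"
    using abs_c_le by (simp add: cmod_def abs_square_le_1)
qed simp

text \<open>Completeness of the Fourier measurement with \<open>J = 1\<close> and Parseval give the
  norm, without tracing unitarity through the run. The Born rule needs it.\<close>

lemma norm_squared_state: "norm_squared (vec_of (\<lambda>p. of_real (state T p))) = 1"
proof -
  obtain z where z: "cmod z = 1" "Re z = c" by (rule phase_exists)
  have len: "length (fourier_ops 1) = Q" "\<And>k. k < Q \<Longrightarrow> fourier_ops 1 ! k = fourier_op 1 k"
    by (simp_all add: fourier_ops_def)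
  have "norm_squared (vec_of (\<lambda>p. of_real (state T p))) =
      (\<Sum>k<Q. norm_squared (fourier_op 1 k *\<^sub>v vec_of (\<lambda>p. of_real (state T p))))"
    using sum_norm_squared_measurement[OF is_measurement_fourier_ops[of 1] vec_of_carrier]
    by (simp add: len del: One_nat_def)
  also have "\<dots> = ((\<Sum>k<Q. phase_weight z k) + (\<Sum>k<Q. phase_weight (cnj z) k)) / 2 / Q"
    by (simp add: norm_squared_fourier_state[OF z] sum.distrib flip: sum_divide_distrib)
  also have "\<dots> = 1" using z by (simp add: sum_phase_weight)
  finally show ?thesis .
qed

text \<open>The interval of radius \<open>J * e\<close> around the measured value is cut into
  \<open>J\<close> pieces of length \<open>2 * e\<close>, and the estimates are their
  midpoints.\<close>

lemma estimate_exists: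
  assumes "\<bar>Re (root_unity Q j) - c\<bar> \<le> J * e" "J > 0" "e > 0"
  obtains s where "s < J" "\<bar>estimate J e j s - c\<bar> \<le> e"
proof -
  define d where "d = c - Re (root_unity Q j) + J * e"
  define i where "i = nat \<lfloor>d / (2 * e)\<rfloor>"
  have d: "0 \<le> d" "d \<le> 2 * J * e" using assms(1) by (auto simp: d_def abs_le_iff algebra_simps)
  have i: "real i \<le> d / (2 * e)" "d / (2 * e) < real i + 1"
    using d assms(3) unfolding i_def by (auto simp: of_nat_floor)
  then have i': "2 * real i * e \<le> d" "d < 2 * (real i + 1) * e"
    using assms(3) by (auto simp: field_simps)
  show ?thesis
  proof (cases "i < J")
    case True
    then show ?thesis using i' that[of i] by (auto simp: estimate_def d_def abs_le_iff algebra_simps)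
  next
    \<comment> \<open>This happens only at the right endpoint of the whole interval, which belongs
      to the last piece.\<close>
    case False
    then have "2 * real J * e \<le> 2 * real i * e" using assms(3) by simp
    then have "d = 2 * J * e" using i' d by linarith
    then show ?thesis
      using that[of "J - 1"] assms(2,3)
      by (auto simp: estimate_def d_def abs_le_iff algebra_simps of_nat_diff)
  qed
qed

text \<open>Every \<open>j\<close> that is not far has at least one good guess \<open>s\<close>
  among \<open>J\<close>, and each pair of \<open>j\<close> and \<open>s\<close> has probability
  \<open>P j\<close>, which already contains the factor \<open>1 / J\<close>.\<close>

lemma prob_estimate:
  assumes J: "J > 0" and e: "e > 0" and m: "m > 0" and L: "L > 0" "real L * (real J * e) \<ge> 4"
    and T_eq: "T = m * (L - 1)"
    and window: "\<And>\<zeta>::complex. (cmod (\<Sum>k\<le>m * (L - 1). of_real (a k) * \<zeta> ^ k))\<^sup>2 \<le>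
       real (m * L) * cmod ((\<Sum>k<L. \<zeta> ^ k) / of_nat L) ^ (2 * m)"
  shows "measure_pmf.prob (run n w o' (Measure (fourier_ops J)
      (\<lambda>k. Output (estimate J e (k div J) (k mod J)))) (vec_of (\<lambda>p. of_real (state T p))))
      {\<alpha>. \<alpha> - e \<le> c \<and> c \<le> \<alpha> + e} \<ge> (1 - m / 4 ^ (m - 1)) / J"
proof -
  define S where "S = {\<alpha>. \<alpha> - e \<le> c \<and> c \<le> \<alpha> + e}"
  define P where "P j = norm_squared (fourier_op J j *\<^sub>v vec_of (\<lambda>p. of_real (state T p)))" for j
  define far where "far = {j. j < Q \<and> \<bar>Re (root_unity Q j) - c\<bar> > J * e}"
  obtain z where z: "cmod z = 1" "Re z = c" by (rule phase_exists)
  have P: "P j = (phase_weight z j + phase_weight (cnj z) j) / 2 / (Q * real J)" for j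
    unfolding P_def by (rule norm_squared_fourier_state[OF z])
  have P_nonneg: "P j \<ge> 0" for j by (simp add: P_def norm_squared_nonneg)
  have sumP: "(\<Sum>j\<in>B. P j) =
      ((\<Sum>j\<in>B. phase_weight z j) + (\<Sum>j\<in>B. phase_weight (cnj z) j)) / 2 / (Q * real J)" for B
    unfolding P by (simp only: sum.distrib flip: sum_divide_distrib)
  have total: "(\<Sum>j<Q. P j) = 1 / J"
    unfolding sumP using z by (simp add: sum_phase_weight)
  have tail: "(\<Sum>j\<in>far. phase_weight z' j) \<le> Q * (m / 4 ^ (m - 1))" if "cmod z' = 1" "Re z' = c" for z'
    unfolding far_def phase_weight_def that(2)[symmetric]
    using a(1) T T_eq J e by (intro phase_estimation_tail[OF _ window L m]) (auto simp: that)
  have "(\<Sum>j\<in>far. P j) \<le> (Q * (m / 4 ^ (m - 1)) + Q * (m / 4 ^ (m - 1))) / 2 / (Q * real J)"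
    unfolding sumP using z by (intro divide_right_mono add_mono tail) auto
  also have "\<dots> = m / 4 ^ (m - 1) / J" by simp
  finally have far: "(\<Sum>j\<in>far. P j) \<le> m / 4 ^ (m - 1) / J" .
  have "(\<Sum>j<Q. P j) - (\<Sum>j\<in>far. P j) = (\<Sum>j\<in>{..<Q} - far. P j)"
    by (subst sum_diff) (auto simp: far_def)
  also have "\<dots> = (\<Sum>j<Q. if j \<in> far then 0 else P j)"
    by (intro sum.mono_neutral_cong_left) auto
  also have "\<dots> \<le> (\<Sum>j<Q. \<Sum>s<J. if estimate J e j s \<in> S then P j else 0)"
  proof (rule sum_mono)
    fix j assume "j \<in> {..<Q}"
    show "(if j \<in> far then 0 else P j) \<le> (\<Sum>s<J. if estimate J e j s \<in> S then P j else 0)"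
    proof (cases "j \<in> far")
      case True
      then show ?thesis by (simp add: sum_nonneg P_nonneg)
    next
      case False
      then have "\<bar>Re (root_unity Q j) - c\<bar> \<le> J * e"
        using \<open>j \<in> {..<Q}\<close> by (auto simp: far_def)
      then obtain s where s: "s < J" "\<bar>estimate J e j s - c\<bar> \<le> e"
        using estimate_exists J e by blast
      then have "estimate J e j s \<in> S" by (auto simp: S_def abs_le_iff)
      then have "P j = (if estimate J e j s \<in> S then P j else 0)" by simp
      also have "\<dots> \<le> (\<Sum>s<J. if estimate J e j s \<in> S then P j else 0)"
        using s by (intro member_le_sum) (auto simp: P_nonneg)
      finally show ?thesis using False by simp
    qed
  qed
  also have "\<dots> = (\<Sum>k<Q * J. if estimate J e (k div J) (k mod J) \<in> S then P (k div J) else 0)"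
    by (rule sum_div_mod[OF J, symmetric])
  also have "\<dots> = (\<Sum>k | k < Q * J \<and> estimate J e (k div J) (k mod J) \<in> S. P (k div J))"
    by (intro sum.mono_neutral_cong_right) auto
  also have "\<dots> = measure_pmf.prob (run n w o' (Measure (fourier_ops J)
      (\<lambda>k. Output (estimate J e (k div J) (k mod J)))) (vec_of (\<lambda>p. of_real (state T p)))) S"
    unfolding P_def by (rule prob_measure_fourier[OF J norm_squared_state, symmetric])
  finally show ?thesis
    using far unfolding total S_def by (simp add: diff_divide_distrib)
qed

lemma output_distribution_walk_algorithm:
  "output_distribution n w f g (walk_algorithm a T y J e) = run n w (case_oracle_name f g)
     (Measure (fourier_ops J) (\<lambda>k. Output (estimate J e (k div J) (k mod J))))
     (vec_of (\<lambda>p. of_real (state T p)))"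
proof -
  have init: "walk_state a T 0 (\<lambda>_. 0) 0 (z, x, b) = a z / sqrt (2 * 2 ^ n) * (if T \<le> z \<and> b = 1 then - 1 else 1)"
    "state 0 (z, x, b) = a z / sqrt (2 * 2 ^ n) * (if T \<le> z \<and> b = 1 then - 1 else 1)" for z x b
    using a(1) by (cases "z \<le> T"; simp add: walk_state_def)+
  have "(\<Sum>p\<in>indices. (walk_state a T 0 (\<lambda>_. 0) 0 p)\<^sup>2) =
      (\<Sum>z<Q. \<Sum>x::nat<2 ^ n. \<Sum>b::nat<2. (a z)\<^sup>2 / (2 * 2 ^ n))"
    unfolding sum_indices by (intro sum.cong refl) (simp add: init power_mult_distrib power_divide)
  also have "\<dots> = 1" using sum_a by simp
  finally have "householder (\<lambda>p. (if p = (0, 0, 0) then 1 else 0) - walk_state a T 0 (\<lambda>_. 0) 0 p) *\<^sub>v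
      unit_vec (total_dim n w) 0 = vec_of (\<lambda>p. of_real (walk_state a T 0 (\<lambda>_. 0) 0 p))"
    by (rule householder_unit_vec)
  also have "\<dots> = vec_of (\<lambda>p. of_real (state 0 p))"
    by (rule vec_of_cong) (auto simp: init)
  finally show ?thesis
    by (simp add: output_distribution_def walk_algorithm_def run_walk_steps del: run.simps(3))
qed

end

section \<open>Choice of parameters\<close>

lemma less_two_power_pred: "m > 0 \<Longrightarrow> m \<le> 2 ^ (m - 1)" for m :: nat
  using less_exp[of "m - 1"] by linarith

text \<open>With \<open>l = ln (1 / \<delta>)\<close>, the choice of \<open>m\<close> makes the tail
  at most \<open>exp (- l) / 2\<close>. For \<open>l < 1 / 4\<close> the success probability before
  guessing is thus at least \<open>1 / 2\<close>, and
  \<open>1 / (2 * J) \<ge> l \<ge> 1 - exp (- l)\<close>; otherwise \<open>J = 1\<close> and the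
  tail bound suffices.\<close>

lemma success_bound:
  fixes l :: real
  assumes l: "l > 0" and J: "J = nat \<lceil>1 / (4 * l)\<rceil>" and m: "m = nat \<lceil>2 * l\<rceil> + 2"
  shows "1 - exp (- l) \<le> (1 - m / 4 ^ (m - 1)) / J"
proof -
  have "real m \<le> 2 ^ (m - 1)"
    using less_two_power_pred[of m] m by (metis add_gr_0 of_nat_le_iff of_nat_numeral of_nat_power zero_less_numeral)
  then have "m / 4 ^ (m - 1) \<le> 2 ^ (m - 1) / (2 ^ (m - 1) * 2 ^ (m - 1) :: real)"
    by (intro frac_le) (simp_all flip: power_mult_distrib)
  also have "\<dots> = 1 / (2 * 2 ^ (m - 2))"
    by (simp add: m)
  also have "\<dots> \<le> 1 / (2 * exp l)"
  proof -
    have "2 * l \<le> real (m - 2)" using l by (simp add: m) 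
    then have "exp l \<le> exp (real (m - 2) * (1 / 2))" by simp
    also have "\<dots> = exp (1 / 2) ^ (m - 2)" by (rule exp_of_nat_mult)
    also have "\<dots> \<le> 2 ^ (m - 2)" by (intro power_mono exp_half_le2) auto
    finally show ?thesis by (simp add: frac_le)
  qed
  finally have tail: "m / 4 ^ (m - 1) \<le> exp (- l) / 2"
    by (simp add: exp_minus field_simps)
  have e: "exp (- l) \<le> 1" "1 - exp (- l) \<le> l"
    using l exp_ge_add_one_self[of "- l"] by auto
  show ?thesis
  proof (cases "l < 1 / 4")
    case True
    \<comment> \<open>Rounding up at most doubles \<open>1 / (4 * l)\<close>, as it exceeds
      \<open>1\<close>.\<close>
    have "real J < 1 / (4 * l) + 1" using l J by simp linarith
    also have "\<dots> \<le> 1 / (2 * l)" using True l by (simp add: field_simps)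
    finally have "real J * l \<le> 1 / 2" using l by (simp add: field_simps)
    moreover have "real J > 0" using l J by simp
    ultimately have "l \<le> (1 / 2) / J" by (simp add: field_simps)
    also have "\<dots> \<le> (1 - m / 4 ^ (m - 1)) / J"
      using tail e by (intro divide_right_mono) linarith+
    finally show ?thesis using e by linarith
  next
    case False
    then have "1 / (4 * l) \<le> 1" "1 / (4 * l) > 0" by (auto simp: field_simps)
    then have "\<lceil>1 / (4 * l)\<rceil> = 1" by linarith
    then have "J = 1" by (simp add: J)
    moreover have "m / 4 ^ (m - 1) \<le> exp (- l)"
      using tail exp_gt_zero[of "- l"] by linarith
    ultimately show ?thesis by simp
  qed
qed

text \<open>The constant is \<open>112 = 2 * 14 * 4\<close>: two queries per step,
  \<open>m \<le> 14 * (l * J)\<close> and \<open>L - 1 \<le> 4 / (J * e)\<close>. The factor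
  \<open>J\<close> cancels.\<close>

lemma query_bound:
  fixes l e :: real
  assumes l: "l > 0" and e: "e > 0" and J: "J = nat \<lceil>1 / (4 * l)\<rceil>" and m: "m = nat \<lceil>2 * l\<rceil> + 2"
    and L: "L = nat \<lfloor>4 / (J * e)\<rfloor> + 1"
  shows "real (2 * (m * (L - 1))) \<le> 112 * (pi / e * l)"
proof -
  have J1: "real J \<ge> 1" and Jl: "real J \<ge> 1 / (4 * l)"
    using l J by (simp_all add: Suc_le_eq) 
  have "real m \<le> 2 * l + 3" using l m by simp linarith
  \<comment> \<open>For \<open>l < 1 / 4\<close> the left side is below \<open>7 / 2\<close> while
    \<open>l * J \<ge> 1 / 4\<close>; for \<open>l \<ge> 1 / 4\<close> already
    \<open>3 \<le> 12 * l\<close>.\<close>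
  also have "\<dots> \<le> 14 * (l * J)"
  proof (cases "l < 1 / 4")
    case True
    then show ?thesis using Jl l by (simp add: field_simps)
  next
    case False
    then have "2 * l + 3 \<le> 14 * (l * 1)" by simp
    also have "\<dots> \<le> 14 * (l * J)" using J1 l by (intro mult_left_mono) auto
    finally show ?thesis .
  qed
  finally have m14: "real m \<le> 14 * (l * J)" .
  have "real (L - 1) \<le> 4 / (J * e)" using L J1 e by simp
  then have "real (2 * (m * (L - 1))) \<le> 2 * ((14 * (l * J)) * (4 / (J * e)))"
    using m14 l unfolding of_nat_mult by (intro mult_mono) auto
  also have "\<dots> = 112 * (1 / e * l)" using J1 by (simp add: field_simps)
  also have "\<dots> \<le> 112 * (pi / e * l)"
    using l e pi_ge_two by (intro mult_left_mono mult_right_mono divide_right_mono) auto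
  finally show ?thesis .
qed

theorem theorem7:
  shows "\<exists>K::real. \<forall>(n::nat) (y::nat) (\<epsilon>::real) (\<delta>::real).
    y < 2 ^ n \<and> 0 < \<epsilon> \<and> \<epsilon> \<le> 1 / 4 \<and> 0 < \<delta> \<and> \<delta> < 1 \<longrightarrow>
    (\<exists>w A. wf_algorithm n w A \<and>
       real (query_count A) \<le> K * (pi / \<epsilon> * ln (1 / \<delta>)) \<and>
       (\<forall>f \<in> sign_functions n. \<forall>g \<in> sign_functions n.
          measure_pmf.prob (output_distribution n w f g A)
            {\<alpha>. \<alpha> - \<epsilon> \<le> real_of_int (cross_correlation n f g y) / 2 ^ n \<and>
                real_of_int (cross_correlation n f g y) / 2 ^ n \<le> \<alpha> + \<epsilon>} \<ge> 1 - \<delta>))"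
proof (intro exI[of _ "112 :: real"] allI impI, elim conjE)
  fix n y :: nat and \<epsilon> \<delta> :: real
  assume y: "y < 2 ^ n" and \<epsilon>: "0 < \<epsilon>" and \<delta>: "0 < \<delta>" "\<delta> < 1"
  define l where "l = ln (1 / \<delta>)"
  define J where "J = nat \<lceil>1 / (4 * l)\<rceil>"
  define m where "m = nat \<lceil>2 * l\<rceil> + 2"
  \<comment> \<open>The floor plus one gives \<open>L * J * \<epsilon> \<ge> 4\<close> while
    \<open>L - 1\<close> stays at most \<open>4 / (J * \<epsilon>)\<close>. For
    \<open>J * \<epsilon> > 4\<close> it gives \<open>L = 1\<close>, hence \<open>T = 0\<close> and
    an algorithm without queries.\<close>
  define L where "L = nat \<lfloor>4 / (J * \<epsilon>)\<rfloor> + 1"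
  define T where "T = m * (L - 1)"
  have l: "l > 0" "exp (- l) = \<delta>" using \<delta> by (simp_all add: l_def ln_div)
  have J: "J > 0" using l by (simp add: J_def)
  have m: "m > 0" by (simp add: m_def)
  have L: "L > 0" "real L * (real J * \<epsilon>) \<ge> 4"
  proof -
    show "L > 0" by (simp add: L_def)
    have "4 / (J * \<epsilon>) \<le> real L" unfolding L_def using J \<epsilon> by simp linarith
    then show "real L * (real J * \<epsilon>) \<ge> 4" using J \<epsilon> by (simp add: field_simps)
  qed
  obtain a :: "nat \<Rightarrow> real" where a: "\<And>k. k > m * (L - 1) \<Longrightarrow> a k = 0" "(\<Sum>k\<le>m * (L - 1). (a k)\<^sup>2) = 1"
    and window: "\<And>\<zeta>::complex. (cmod (\<Sum>k\<le>m * (L - 1). of_real (a k) * \<zeta> ^ k))\<^sup>2 \<le>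
       real (m * L) * cmod ((\<Sum>k<L. \<zeta> ^ k) / of_nat L) ^ (2 * m)"
    by (rule window_amplitudes[OF L(1) m]) (rule that)
  let ?A = "register.walk_algorithm n T a T y J \<epsilon>"
  show "\<exists>w A. wf_algorithm n w A \<and> real (query_count A) \<le> 112 * (pi / \<epsilon> * ln (1 / \<delta>)) \<and>
       (\<forall>f \<in> sign_functions n. \<forall>g \<in> sign_functions n.
          measure_pmf.prob (output_distribution n w f g A)
            {\<alpha>. \<alpha> - \<epsilon> \<le> real_of_int (cross_correlation n f g y) / 2 ^ n \<and>
                real_of_int (cross_correlation n f g y) / 2 ^ n \<le> \<alpha> + \<epsilon>} \<ge> 1 - \<delta>)"
  \<comment> \<open>The control register only has to hold the values up to \<open>T\<close>;
    \<open>T\<close> qubits suffice because \<open>T < 2 ^ T\<close>.\<close>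
  proof (intro exI[of _ T] exI[of _ ?A] conjI ballI)
    show "wf_algorithm n T ?A"
      by (rule register.wf_walk_algorithm[OF y J])
    show "real (query_count ?A) \<le> 112 * (pi / \<epsilon> * ln (1 / \<delta>))"
      unfolding register.query_count_walk_algorithm[OF J] T_def l_def[symmetric]
      by (rule query_bound[OF l(1) \<epsilon> J_def m_def L_def])
    fix f g assume "f \<in> sign_functions n" "g \<in> sign_functions n"
    then interpret walk n T f g y T a
      by unfold_locales (use y a[folded T_def] less_exp in auto)
    have "1 - \<delta> \<le> (1 - m / 4 ^ (m - 1)) / J"
      using success_bound[OF l(1) J_def m_def] l by simp
    also have "\<dots> \<le> measure_pmf.prob (output_distribution n T f g ?A) {\<alpha>. \<alpha> - \<epsilon> \<le> c \<and> c \<le> \<alpha> + \<epsilon>}"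
      unfolding output_distribution_walk_algorithm
      by (rule prob_estimate[OF J \<epsilon> m L T_def window])
    finally show "1 - \<delta> \<le> measure_pmf.prob (output_distribution n T f g ?A)
            {\<alpha>. \<alpha> - \<epsilon> \<le> real_of_int (cross_correlation n f g y) / 2 ^ n \<and>
                real_of_int (cross_correlation n f g y) / 2 ^ n \<le> \<alpha> + \<epsilon>}"
      by (simp add: c_def)
  qed
qed

end
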